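(* Let $E$ be an lcHs over $\mathbb{K}$ and let $(T^{E}_{m},T^{\mathbb{K}}_{m})_{m\in M}$ be a consistent generator for $(\mathcal{FV},E)$. Then the map \[ S\colon \mathcal{FV}(\Omega)\varepsilon E\to\mathcal{FV}(\Omega,E),\; u\longmapsto [x\mapsto u(\delta_{x})], \] is a well-defined isomorphism into, i.e. $\mathcal{FV}(\Omega)$ and $\mathcal{FV}(\Omega,E)$ are $\varepsilon$-into-compatible.
   Context: $\mathbb{K}=\mathbb{R}$ or $\mathbb{C}$. An lcHs is a non-trivial ($\neq\{0\}$) locally convex Hausdorff space over $\mathbb{K}$; the topology of $E$ is given by a directed system of seminorms $(p_{\alpha})_{\alpha\in\mathfrak{A}}$ (for $E=\mathbb{K}$ it is $\{|\cdot|\}$). For an lcHs $F$, $F'_{\kappa}$ is the dual $F'$ with the topology of uniform convergence on absolutely convex compact subsets of $F$, and $F\varepsilon E:=L_{e}(F'_{\kappa},E)$ is the space of continuous linear maps $F'_\kappa\to E$ with the topology of uniform convergence on equicontinuous subsets of $F'$. "Isomorphism" means linear topological isomorphism, "isomorphism into" means isomorphism onto its range (with the induced topology). $\delta_x(f):=f(x)$. $\varepsilon$-into-compatible: lcHs $\mathcal{F}(\Omega)\subset\mathbb{K}^{\Omega}$, $\mathcal{F}(\Omega,E)\subset E^{\Omega}$ with $\delta_x\in\mathcal{F}(\Omega)'$ for all $x\in\Omega$ are $\varepsilon$-into-compatible if $S\colon\mathcal{F}(\Omega)\varepsilon E\to\mathcal{F}(\Omega,E)$, $u\mapsto[x\mapsto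 u(\delta_x)]$, is a well-defined isomorphism into. Weighted spaces: Let $\Omega$, $J$, $M$ be non-empty sets, $(\omega_m)_{m\in M}$ a family of non-empty sets (not necessarily subsets of $\Omega$), and $\mathcal{V}=(\nu_{j,m})_{j\in J,m\in M}$ a family of weight functions, i.e. $\nu_{j,m}\colon\omega_m\to[0,\infty)$ and for all $m\in M$, $x\in\omega_m$ there is $j\in J$ with $\nu_{j,m}(x)>0$. For $Y\in\{\mathbb{K},E\}$ let $T^{Y}_m\colon Y^{\Omega}\supset\operatorname{dom}T^{Y}_m\to Y^{\omega_m}$ be linear for each $m\in M$, $\operatorname{AP}(\Omega,Y)$ a linear subspace of $Y^{\Omega}$, $F(\Omega,Y):=\operatorname{AP}(\Omega,Y)\cap\bigcap_{m\in M}\operatorname{dom}T^{Y}_m$ and \[ \mathcal{FV}(\Omega,Y):=\{f\in F(\Omega,Y)\;|\;\forall j\in J,m\in M,\alpha:\ |f|_{j,m,\alpha}:=\sup_{x\in\omega_m}p_\alpha(T^{Y}_m(f)(x))\nu_{j,m}(x)<\infty\}, \] equipped with these seminorms; $F(\Omega):=F(\Omega,\mathbb{K})$, $\mathcal{FV}(\Omega):=\mathcal{FV}(\Omega,\mathbb{K})$. Here the sets $\Omega$, $J$, $M$, $\omega_m$ and the weights $\mathcal{V}$ are the same for $Y=\mathbb{K}$ and $Y=E$. $\mathcal{FV}(\Omega,Y)$ is a dom-space if it is Hausdorff, the system $(|\cdot|_{j,m,\alpha})$ is directed and, if $Y=\mathbb{K}$, $\delta_x\in\mathcal{FV}(\Omega)'$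 for all $x\in\Omega$. Put $T^{\mathbb{K}}_{m,x}(f):=T^{\mathbb{K}}_m(f)(x)$; one has $T^{\mathbb{K}}_{m,x}\in\mathcal{FV}(\Omega)'$. $(T^{E}_m,T^{\mathbb{K}}_m)_{m\in M}$ is a generator for $(\mathcal{FV},E)$ if the weighted spaces $\mathcal{FV}(\Omega)$ (defined by the operators $T^{\mathbb{K}}_m$, the space $\operatorname{AP}(\Omega,\mathbb{K})$ and the weights $\nu_{j,m}$ on $\omega_m$) and $\mathcal{FV}(\Omega,E)$ (defined by the operators $T^{E}_m$, the space $\operatorname{AP}(\Omega,E)$ and the same weights $\nu_{j,m}$ on the same sets $\omega_m$, $j\in J$, $m\in M$) are dom-spaces. It is consistent if for all $u\in\mathcal{FV}(\Omega)\varepsilon E$ one has $S(u)\in F(\Omega,E)$ and $(T^{E}_mS(u))(x)=u(T^{\mathbb{K}}_{m,x})$ for all $m\in M$, $x\in\omega_m$, where $S(u)(x):=u(\delta_x)$. *)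

theory Defs
  imports "HOL-Analysis.Analysis" "HOL-Library.Function_Algebras"
begin

text \<open>The scalar field: a normed field that is, isometrically, either \<open>\<real>\<close> or \<open>\<complex>\<close>.\<close>

class real_or_complex = real_normed_field +
  assumes real_or_complex:
    "(\<forall>z. \<exists>a. z = a *\<^sub>R 1) \<or>
     (\<exists>i. i * i = - 1 \<and> (\<forall>z. \<exists>a b. z = a *\<^sub>R 1 + b *\<^sub>R i) \<and>
          (\<forall>a b. norm (a *\<^sub>R 1 + b *\<^sub>R i) = sqrt (a\<^sup>2 + b\<^sup>2)))"

instance real :: real_or_complex
  by standard simp

instance complex :: real_or_complex
proof
  have "\<exists>a b. z = a *\<^sub>R 1 + b *\<^sub>R \<i>" for z
    by (intro exI[of _ "Re z"] exI[of _ "Im z"]) (simp add: complex_eq_iff)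
  moreover have "norm (a *\<^sub>R 1 + b *\<^sub>R \<i>) = sqrt (a\<^sup>2 + b\<^sup>2)" for a b
    by (simp add: cmod_def)
  ultimately show "(\<forall>z::complex. \<exists>a. z = a *\<^sub>R 1) \<or>
     (\<exists>i::complex. i * i = - 1 \<and> (\<forall>z. \<exists>a b. z = a *\<^sub>R 1 + b *\<^sub>R i) \<and>
          (\<forall>a b. norm (a *\<^sub>R 1 + b *\<^sub>R i) = sqrt (a\<^sup>2 + b\<^sup>2)))"
    by (intro disjI2 exI[of _ "\<i>"]) simp
qed


section \<open>Locally convex spaces\<close>

text \<open>A space is given by a carrier inside an ambient additive group, a scalar multiplication
  and a set of seminorms. Function spaces use the pointwise addition of
  \<^theory>\<open>HOL-Library.Function_Algebras\<close>.\<close>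

record ('k, 'v) lcs =
  vcar :: "'v set"
  scl :: "'k \<Rightarrow> 'v \<Rightarrow> 'v"
  snorms :: "('v \<Rightarrow> real) set"

text \<open>Finite sets of seminorms are used in the neighbourhoods, so that the topology is the right
  one also for systems that are not known to be directed.\<close>

definition lcs_open :: "('k, 'v::ab_group_add) lcs \<Rightarrow> 'v set \<Rightarrow> bool" where
  "lcs_open V U \<longleftrightarrow> U \<subseteq> vcar V \<and>
     (\<forall>v\<in>U. \<exists>Q r. finite Q \<and> Q \<subseteq> snorms V \<and> 0 < r \<and>
        {w \<in> vcar V. \<forall>q\<in>Q. q (w - v) < r} \<subseteq> U)"

definition lcs_top :: "('k, 'v::ab_group_add) lcs \<Rightarrow> 'v topology" where
  "lcs_top V = topology (lcs_open V)"

lemma istopology_lcs_open: "istopology (lcs_open V)"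
proof -
  define N where "N v Q r = {w \<in> vcar V. \<forall>q\<in>Q. q (w - v) < r}" for v Q and r :: real
  have op: "lcs_open V U \<longleftrightarrow> U \<subseteq> vcar V \<and>
      (\<forall>v\<in>U. \<exists>Q r. finite Q \<and> Q \<subseteq> snorms V \<and> 0 < r \<and> N v Q r \<subseteq> U)" for U
    by (simp add: lcs_open_def N_def)
  have N: "N v (Q \<union> Q') (min r r') \<subseteq> N v Q r \<inter> N v Q' r'" for v Q Q' r r'
    by (simp add: N_def subset_iff)
  show ?thesis
    unfolding istopology_def
  proof (intro conjI allI impI)
    fix S T assume S: "lcs_open V S" and T: "lcs_open V T"
    have "\<exists>Q r. finite Q \<and> Q \<subseteq> snorms V \<and> 0 < r \<and> N v Q r \<subseteq> S \<inter> T"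
      if v: "v \<in> S" "v \<in> T" for v
    proof -
      obtain Q r where Q: "finite Q" "Q \<subseteq> snorms V" "0 < r" "N v Q r \<subseteq> S"
        using S v(1) unfolding op by meson
      obtain Q' r' where Q': "finite Q'" "Q' \<subseteq> snorms V" "0 < r'" "N v Q' r' \<subseteq> T"
        using T v(2) unfolding op by meson
      have "N v (Q \<union> Q') (min r r') \<subseteq> S \<inter> T"
        using N Q(4) Q'(4) by (meson Int_mono subset_trans)
      moreover have "finite (Q \<union> Q')" "Q \<union> Q' \<subseteq> snorms V" "0 < min r r'"
        using Q Q' by simp_all
      ultimately show ?thesis by (intro exI conjI)
    qed
    with S show "lcs_open V (S \<inter> T)" unfolding op by (simp add: le_infI1)
  next
    fix \<K> assume K: "\<forall>K\<in>\<K>. lcs_open V K"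
    have "\<exists>Q r. finite Q \<and> Q \<subseteq> snorms V \<and> 0 < r \<and> N v Q r \<subseteq> \<Union>\<K>"
      if U: "U \<in> \<K>" "v \<in> U" for U v
    proof -
      obtain Q r where Q: "finite Q" "Q \<subseteq> snorms V" "0 < r" "N v Q r \<subseteq> U"
        using K U unfolding op by meson
      have "N v Q r \<subseteq> \<Union>\<K>" using Q(4) Union_upper[OF U(1)] by (rule subset_trans)
      with Q(1-3) show ?thesis by (intro exI conjI)
    qed
    moreover have "\<Union>\<K> \<subseteq> vcar V" using K unfolding op by (meson Union_least)
    ultimately show "lcs_open V (\<Union>\<K>)" unfolding op by (meson UnionE)
  qed
qed

lemma openin_lcs_top: "openin (lcs_top V) U \<longleftrightarrow> lcs_open V U"
  by (simp add: lcs_top_def istopology_lcs_open topology_inverse')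

lemma topspace_lcs_top [simp]: "topspace (lcs_top V) = vcar V"
proof (rule antisym)
  show "topspace (lcs_top V) \<subseteq> vcar V"
    using openin_topspace[of "lcs_top V"] unfolding openin_lcs_top lcs_open_def by (rule conjunct1)
  have "\<exists>Q r. finite Q \<and> Q \<subseteq> snorms V \<and> 0 < r \<and>
      {w \<in> vcar V. \<forall>q\<in>Q. q (w - v) < r} \<subseteq> vcar V" for v
    by (rule exI[of _ "{}"], rule exI[of _ 1]) simp
  then have "openin (lcs_top V) (vcar V)"
    unfolding openin_lcs_top lcs_open_def by simp
  then show "vcar V \<subseteq> topspace (lcs_top V)" by (rule openin_subset)
qed

definition seminorm_on :: "('k::real_normed_field, 'v::ab_group_add) lcs \<Rightarrow> ('v \<Rightarrow> real) \<Rightarrow> bool" where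
  "seminorm_on V q \<longleftrightarrow>
     (\<forall>v\<in>vcar V. 0 \<le> q v) \<and>
     (\<forall>v\<in>vcar V. \<forall>w\<in>vcar V. q (v + w) \<le> q v + q w) \<and>
     (\<forall>v\<in>vcar V. \<forall>c. q (scl V c v) = norm c * q v)"

definition directed_snorms :: "('k, 'v) lcs \<Rightarrow> bool" where
  "directed_snorms V \<longleftrightarrow> snorms V \<noteq> {} \<and>
     (\<forall>p\<in>snorms V. \<forall>q\<in>snorms V. \<exists>r\<in>snorms V. \<exists>C\<ge>0. \<forall>v\<in>vcar V. max (p v) (q v) \<le> C * r v)"

definition lc_hausdorff :: "('k::real_or_complex, 'v::ab_group_add) lcs \<Rightarrow> bool" where
  "lc_hausdorff V \<longleftrightarrow>
     vector_space (scl V) \<and> module.subspace (scl V) (vcar V) \<and>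
     (\<forall>q\<in>snorms V. seminorm_on V q) \<and> directed_snorms V \<and> Hausdorff_space (lcs_top V)"

definition lcHs :: "('k::real_or_complex, 'v::ab_group_add) lcs \<Rightarrow> bool" where
  "lcHs V \<longleftrightarrow> lc_hausdorff V \<and> vcar V \<noteq> {0}"

definition scalars :: "('k::real_or_complex, 'k) lcs" where
  "scalars = \<lparr>vcar = UNIV, scl = (*), snorms = {norm}\<rparr>"


section \<open>Linear maps, dual space and epsilon product\<close>

definition linear_on :: "('k, 'v::ab_group_add) lcs \<Rightarrow> ('k, 'w::ab_group_add) lcs \<Rightarrow> ('v \<Rightarrow> 'w) \<Rightarrow> bool" where
  "linear_on V W u \<longleftrightarrow>
     (\<forall>v\<in>vcar V. u v \<in> vcar W) \<and>
     (\<forall>v\<in>vcar V. \<forall>w\<in>vcar V. u (v + w) = u v + u w) \<and>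
     (\<forall>v\<in>vcar V. \<forall>c. u (scl V c v) = scl W c (u v))"

text \<open>Maps defined on a subset only are represented by their extension by zero; this makes the
  representative unique and keeps sets of such maps closed under pointwise addition.\<close>

definition restrict0 :: "'v set \<Rightarrow> ('v \<Rightarrow> 'w::zero) \<Rightarrow> 'v \<Rightarrow> 'w" where
  "restrict0 A u = (\<lambda>v. if v \<in> A then u v else 0)"

definition cont_linear_maps :: "('k, 'v::ab_group_add) lcs \<Rightarrow> ('k, 'w::ab_group_add) lcs \<Rightarrow> ('v \<Rightarrow> 'w) set" where
  "cont_linear_maps V W = {u. linear_on V W u \<and> continuous_map (lcs_top V) (lcs_top W) u \<and>
     (\<forall>v. v \<notin> vcar V \<longrightarrow> u v = 0)}"

definition dual :: "('k::real_or_complex, 'v::ab_group_add) lcs \<Rightarrow> ('v \<Rightarrow> 'k) set" where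
  "dual V = cont_linear_maps V scalars"

definition absolutely_convex :: "('k::real_normed_field, 'v::ab_group_add) lcs \<Rightarrow> 'v set \<Rightarrow> bool" where
  "absolutely_convex V K \<longleftrightarrow> K \<subseteq> vcar V \<and>
     (\<forall>v\<in>K. \<forall>w\<in>K. \<forall>a b. norm a + norm b \<le> 1 \<longrightarrow> scl V a v + scl V b w \<in> K)"

definition equicontinuous :: "('k::real_or_complex, 'v::ab_group_add) lcs \<Rightarrow> ('v \<Rightarrow> 'k) set \<Rightarrow> bool" where
  "equicontinuous V B \<longleftrightarrow> B \<subseteq> dual V \<and>
     (\<forall>v\<in>vcar V. \<forall>\<epsilon>>0. \<exists>U. openin (lcs_top V) U \<and> v \<in> U \<and>
        (\<forall>y\<in>B. \<forall>w\<in>U. norm (y w - y v) < \<epsilon>))"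

text \<open>The suprema in the next two definitions are taken in the reals. They are over non-empty
  sets, and are finite because continuous functionals are bounded on compact sets and continuous
  linear maps on \<open>dual_kappa V\<close> are bounded on equicontinuous sets.\<close>

definition dual_kappa :: "('k::real_or_complex, 'v::ab_group_add) lcs \<Rightarrow> ('k, 'v \<Rightarrow> 'k) lcs" where
  "dual_kappa V = \<lparr>vcar = dual V, scl = (\<lambda>c y v. c * y v),
     snorms = {(\<lambda>y. SUP v\<in>K. norm (y v)) | K.
       K \<noteq> {} \<and> absolutely_convex V K \<and> compactin (lcs_top V) K}\<rparr>"

definition eps_product ::
    "('k::real_or_complex, 'v::ab_group_add) lcs \<Rightarrow> ('k, 'e::ab_group_add) lcs \<Rightarrow> ('k, ('v \<Rightarrow> 'k) \<Rightarrow> 'e) lcs" where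
  "eps_product V E = \<lparr>vcar = cont_linear_maps (dual_kappa V) E, scl = (\<lambda>c u y. scl E c (u y)),
     snorms = {(\<lambda>u. SUP y\<in>B. p (u y)) | B p. B \<noteq> {} \<and> equicontinuous V B \<and> p \<in> snorms E}\<rparr>"

definition iso_into :: "('k, 'v::ab_group_add) lcs \<Rightarrow> ('k, 'w::ab_group_add) lcs \<Rightarrow> ('v \<Rightarrow> 'w) \<Rightarrow> bool" where
  "iso_into V W u \<longleftrightarrow> linear_on V W u \<and> embedding_map (lcs_top V) (lcs_top W) u"


section \<open>Spaces of functions on the type \<open>'w\<close>\<close>

definition all_funs :: "('k, 'y) lcs \<Rightarrow> ('w \<Rightarrow> 'y) set" where
  "all_funs Y = {f. \<forall>x. f x \<in> vcar Y}"

definition pw_scl :: "('k, 'y) lcs \<Rightarrow> 'k \<Rightarrow> ('w \<Rightarrow> 'y) \<Rightarrow> 'w \<Rightarrow> 'y" where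
  "pw_scl Y c f = (\<lambda>x. scl Y c (f x))"

definition lc_hausdorff_fun_space ::
    "('k::real_or_complex, 'y::ab_group_add) lcs \<Rightarrow> ('k, 'w \<Rightarrow> 'y) lcs \<Rightarrow> bool" where
  "lc_hausdorff_fun_space Y V \<longleftrightarrow> vcar V \<subseteq> all_funs Y \<and> scl V = pw_scl Y \<and> lc_hausdorff V"

definition \<delta> :: "('k::real_or_complex, 'w \<Rightarrow> 'k) lcs \<Rightarrow> 'w \<Rightarrow> ('w \<Rightarrow> 'k) \<Rightarrow> 'k" where
  "\<delta> V x = restrict0 (vcar V) (\<lambda>f. f x)"

definition S_map ::
    "('k::real_or_complex, 'w \<Rightarrow> 'k) lcs \<Rightarrow> ((('w \<Rightarrow> 'k) \<Rightarrow> 'k) \<Rightarrow> 'e) \<Rightarrow> 'w \<Rightarrow> 'e" where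
  "S_map V u = (\<lambda>x. u (\<delta> V x))"

definition eps_into_compatible ::
    "('k::real_or_complex, 'w \<Rightarrow> 'k) lcs \<Rightarrow> ('k, 'e::ab_group_add) lcs \<Rightarrow> ('k, 'w \<Rightarrow> 'e) lcs \<Rightarrow> bool" where
  "eps_into_compatible V E VE \<longleftrightarrow>
     lc_hausdorff_fun_space scalars V \<and> lc_hausdorff_fun_space E VE \<and>
     (\<forall>x. \<delta> V x \<in> dual V) \<and>
     iso_into (eps_product V E) VE (S_map V)"


section \<open>Weighted spaces and generators\<close>

text \<open>The sets \<open>\<Omega>\<close>, \<open>J\<close>, \<open>M\<close> are the types \<open>'w\<close>, \<open>'j\<close>, \<open>'m\<close>. The sets \<open>\<omega> m\<close> lie in a common
  type \<open>'x\<close>; the values of \<open>\<nu> j m\<close> and of \<open>oper G m f\<close> outside of \<open>\<omega> m\<close> are irrelevant.\<close>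

record ('w, 'm, 'x, 'y) oper_family =
  AP :: "('w \<Rightarrow> 'y) set"
  dom_op :: "'m \<Rightarrow> ('w \<Rightarrow> 'y) set"
  oper :: "'m \<Rightarrow> ('w \<Rightarrow> 'y) \<Rightarrow> 'x \<Rightarrow> 'y"

definition weight_family :: "('m \<Rightarrow> 'x set) \<Rightarrow> ('j \<Rightarrow> 'm \<Rightarrow> 'x \<Rightarrow> real) \<Rightarrow> bool" where
  "weight_family \<omega> \<nu> \<longleftrightarrow>
     (\<forall>m. \<omega> m \<noteq> {}) \<and>
     (\<forall>j m. \<forall>x\<in>\<omega> m. 0 \<le> \<nu> j m x) \<and>
     (\<forall>m. \<forall>x\<in>\<omega> m. \<exists>j. 0 < \<nu> j m x)"

definition linear_operators ::
    "('m \<Rightarrow> 'x set) \<Rightarrow> ('k::real_or_complex, 'y::ab_group_add) lcs \<Rightarrow> ('w, 'm, 'x, 'y) oper_family \<Rightarrow> bool" where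
  "linear_operators \<omega> Y G \<longleftrightarrow>
     AP G \<subseteq> all_funs Y \<and> module.subspace (pw_scl Y) (AP G) \<and>
     (\<forall>m. dom_op G m \<subseteq> all_funs Y \<and> module.subspace (pw_scl Y) (dom_op G m) \<and>
       (\<forall>x\<in>\<omega> m.
         (\<forall>f\<in>dom_op G m. oper G m f x \<in> vcar Y) \<and>
         (\<forall>f\<in>dom_op G m. \<forall>g\<in>dom_op G m. oper G m (f + g) x = oper G m f x + oper G m g x) \<and>
         (\<forall>f\<in>dom_op G m. \<forall>c. oper G m (pw_scl Y c f) x = scl Y c (oper G m f x))))"

definition F_set :: "('w, 'm, 'x, 'y) oper_family \<Rightarrow> ('w \<Rightarrow> 'y) set" where
  "F_set G = AP G \<inter> (\<Inter>m. dom_op G m)"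

definition weighted_snorm ::
    "('m \<Rightarrow> 'x set) \<Rightarrow> ('j \<Rightarrow> 'm \<Rightarrow> 'x \<Rightarrow> real) \<Rightarrow> ('w, 'm, 'x, 'y) oper_family \<Rightarrow>
     'j \<Rightarrow> 'm \<Rightarrow> ('y \<Rightarrow> real) \<Rightarrow> ('w \<Rightarrow> 'y) \<Rightarrow> real" where
  "weighted_snorm \<omega> \<nu> G j m p f = (SUP x\<in>\<omega> m. p (oper G m f x) * \<nu> j m x)"

definition FV ::
    "('m \<Rightarrow> 'x set) \<Rightarrow> ('j \<Rightarrow> 'm \<Rightarrow> 'x \<Rightarrow> real) \<Rightarrow> ('k, 'y) lcs \<Rightarrow> ('w, 'm, 'x, 'y) oper_family \<Rightarrow>
     ('k, 'w \<Rightarrow> 'y) lcs" where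
  "FV \<omega> \<nu> Y G = \<lparr>
     vcar = {f \<in> F_set G. \<forall>j m. \<forall>p\<in>snorms Y.
       bdd_above ((\<lambda>x. p (oper G m f x) * \<nu> j m x) ` \<omega> m)},
     scl = pw_scl Y,
     snorms = {weighted_snorm \<omega> \<nu> G j m p | j m p. p \<in> snorms Y}\<rparr>"

text \<open>The functional \<open>f \<mapsto> T\<^sub>m(f)(x)\<close> on the scalar-valued weighted space.\<close>

definition T_at ::
    "('m \<Rightarrow> 'x set) \<Rightarrow> ('j \<Rightarrow> 'm \<Rightarrow> 'x \<Rightarrow> real) \<Rightarrow> ('w, 'm, 'x, 'k::real_or_complex) oper_family \<Rightarrow>
     'm \<Rightarrow> 'x \<Rightarrow> ('w \<Rightarrow> 'k) \<Rightarrow> 'k" where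
  "T_at \<omega> \<nu> G m x = restrict0 (vcar (FV \<omega> \<nu> scalars G)) (\<lambda>f. oper G m f x)"

definition dom_space ::
    "('m \<Rightarrow> 'x set) \<Rightarrow> ('j \<Rightarrow> 'm \<Rightarrow> 'x \<Rightarrow> real) \<Rightarrow> ('k, 'y::ab_group_add) lcs \<Rightarrow>
     ('w, 'm, 'x, 'y) oper_family \<Rightarrow> bool" where
  "dom_space \<omega> \<nu> Y G \<longleftrightarrow>
     Hausdorff_space (lcs_top (FV \<omega> \<nu> Y G)) \<and> directed_snorms (FV \<omega> \<nu> Y G)"

definition scalar_dom_space ::
    "('m \<Rightarrow> 'x set) \<Rightarrow> ('j \<Rightarrow> 'm \<Rightarrow> 'x \<Rightarrow> real) \<Rightarrow>
     ('w, 'm, 'x, 'k::real_or_complex) oper_family \<Rightarrow> bool" where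
  "scalar_dom_space \<omega> \<nu> G \<longleftrightarrow>
     dom_space \<omega> \<nu> scalars G \<and>
     (\<forall>x. \<delta> (FV \<omega> \<nu> scalars G) x \<in> dual (FV \<omega> \<nu> scalars G))"

definition generator ::
    "('m \<Rightarrow> 'x set) \<Rightarrow> ('j \<Rightarrow> 'm \<Rightarrow> 'x \<Rightarrow> real) \<Rightarrow> ('k::real_or_complex, 'e::ab_group_add) lcs \<Rightarrow>
     ('w, 'm, 'x, 'e) oper_family \<Rightarrow> ('w, 'm, 'x, 'k) oper_family \<Rightarrow> bool" where
  "generator \<omega> \<nu> E GE GK \<longleftrightarrow>
     weight_family \<omega> \<nu> \<and> linear_operators \<omega> E GE \<and> linear_operators \<omega> scalars GK \<and>
     dom_space \<omega> \<nu> E GE \<and> scalar_dom_space \<omega> \<nu> GK"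

definition consistent ::
    "('m \<Rightarrow> 'x set) \<Rightarrow> ('j \<Rightarrow> 'm \<Rightarrow> 'x \<Rightarrow> real) \<Rightarrow> ('k::real_or_complex, 'e::ab_group_add) lcs \<Rightarrow>
     ('w, 'm, 'x, 'e) oper_family \<Rightarrow> ('w, 'm, 'x, 'k) oper_family \<Rightarrow> bool" where
  "consistent \<omega> \<nu> E GE GK \<longleftrightarrow>
     (\<forall>u \<in> vcar (eps_product (FV \<omega> \<nu> scalars GK) E).
        S_map (FV \<omega> \<nu> scalars GK) u \<in> F_set GE \<and>
        (\<forall>m. \<forall>x\<in>\<omega> m. oper GE m (S_map (FV \<omega> \<nu> scalars GK) u) x = u (T_at \<omega> \<nu> GK m x)))"

end

theory Submission
  imports Defs
begin

text \<open>Put \<open>B\<^sub>j\<^sub>m = {\<nu>\<^sub>j\<^sub>m(x) T\<^sub>m\<^sub>,\<^sub>x | x \<in> \<omega>\<^sub>m}\<close>, an equicontinuous set. Consistency turns the weighted seminorm of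
  \<open>S(u)\<close> into the supremum of \<open>p(u(y))\<close> over \<open>y \<in> B\<^sub>j\<^sub>m\<close>, whence \<open>S\<close> is well defined and continuous.
  Conversely, every equicontinuous \<open>B\<close> lies in a multiple of the bipolar of finitely many
  \<open>B\<^sub>j\<^sub>m\<close>. For \<open>y \<in> B\<close> choose by Hahn--Banach a real functional \<open>e'\<close> with \<open>e' \<le> p\<close> and
  \<open>e'(u(y)) = p(u(y))\<close>. As \<open>e' \<circ> u\<close> is continuous on the dual with the topology \<open>\<kappa>\<close>, by Mackey--Arens
  it is the real part of the evaluation at some \<open>f\<close> in the scalar weighted space, and then
  \<open>p(u(y)) = Re y(f)\<close> is controlled by the values at \<open>f\<close> of the elements of the \<open>B\<^sub>j\<^sub>m\<close>, that is,
  by weighted seminorms of \<open>S(u)\<close>.\<close>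

text \<open>The obstacle is the lower estimate: S(u) controls \<open>u\<close> only on the
  functionals \<open>weighted_T j m x\<close>, whereas an equicontinuous set consists of functionals
  that are merely dominated by weighted seminorms and need not be linear combinations of these. The
  scalar seminorms are themselves suprema over such functionals, so domination of \<open>y\<close>
  by the sum of a finite set \<open>Q\<close> of seminorms gives |y(f)| \<le> C * card Q * M as soon
  as M bounds all |a(f)| with \<open>a\<close> in the corresponding sets. This is a statement about
  points f and not about maps \<open>u\<close>; Hahn-Banach and Mackey-Arens serve to trade the map
  for a point. The point exists because the seminorms of the topology \<kappa> are suprema over
  compact absolutely convex sets: compactness gives a minimiser and then a common solution of
  infinitely many equations, while absolute convexity gives segments and rotations. Real-valued
  functionals treat both scalar fields at once, and moduli are recovered by rotating with a scalar
  of norm one. The Hausdorff property of \<open>E\<close> turns the lower estimate into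
  injectivity.\<close>

section \<open>The Hahn--Banach theorem\<close>

text \<open>The value 0 outside \<open>X\<close> makes the pointwise order on total functions the
  order of their restrictions to \<open>X\<close>, so that a minimal element is determined as a
  total function.\<close>

definition sublinear_on :: "(real \<Rightarrow> 'e::ab_group_add \<Rightarrow> 'e) \<Rightarrow> 'e set \<Rightarrow> ('e \<Rightarrow> real) \<Rightarrow> bool" where
  "sublinear_on s X q \<longleftrightarrow>
     (\<forall>x\<in>X. \<forall>y\<in>X. q (x + y) \<le> q x + q y) \<and>
     (\<forall>x\<in>X. \<forall>t\<ge>0. q (s t x) = t * q x) \<and>
     (\<forall>x. x \<notin> X \<longrightarrow> q x = 0)"

locale real_subspace =
  vector_space s for s :: "real \<Rightarrow> 'e::ab_group_add \<Rightarrow> 'e" +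
  fixes X :: "'e set"
  assumes X: "subspace X"
begin

lemmas X_closed [simp] = subspace_0[OF X] subspace_add[OF X] subspace_scale[OF X]
  subspace_neg[OF X] subspace_diff[OF X]

lemma sublinear_onD:
  assumes "sublinear_on s X q"
  shows "x \<in> X \<Longrightarrow> y \<in> X \<Longrightarrow> q (x + y) \<le> q x + q y"
    "x \<in> X \<Longrightarrow> 0 \<le> t \<Longrightarrow> q (s t x) = t * q x"
    "x \<notin> X \<Longrightarrow> q x = 0"
  using assms unfolding sublinear_on_def by blast+

lemma sublinear_on_zero: "sublinear_on s X q \<Longrightarrow> q 0 = 0"
  using sublinear_onD(2)[of q 0 0] by simp

lemma sublinear_on_neg:
  assumes "sublinear_on s X q" "x \<in> X"
  shows "- q (- x) \<le> q x"
  using sublinear_onD(1)[OF assms(1), of x "- x"] assms sublinear_on_zero[OF assms(1)] by simp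

text \<open>Homogeneity only needs to be checked as an inequality, by rescaling with the inverse.\<close>

lemma sublinear_onI:
  assumes add: "\<And>x y. x \<in> X \<Longrightarrow> y \<in> X \<Longrightarrow> q (x + y) \<le> q x + q y"
    and scale: "\<And>x t. x \<in> X \<Longrightarrow> 0 < t \<Longrightarrow> q (s t x) \<le> t * q x"
    and zero: "q 0 = 0" "\<And>x. x \<notin> X \<Longrightarrow> q x = 0"
  shows "sublinear_on s X q"
  unfolding sublinear_on_def
proof (intro conjI ballI allI impI)
  fix x t assume x: "x \<in> X" and t: "(0::real) \<le> t"
  show "q (s t x) = t * q x"
  proof (cases "t = 0")
    case False
    with t have t: "t > 0" by simp
    have "q (s (inverse t) (s t x)) \<le> inverse t * q (s t x)"
      by (rule scale) (use x t in simp_all)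
    moreover have "s (inverse t) (s t x) = x" using t by simp
    ultimately have "t * q x \<le> q (s t x)"
      using t by (simp add: field_simps)
    with scale[OF x t] show ?thesis by simp
  qed (simp add: zero)
qed (use add zero in auto)

text \<open>The smaller functional is the infimum over t \<ge> 0 of q(x + t a) - t q(a): t = 0 gives
  the bound by \<open>q\<close>, and t = 1 at \<open>- a\<close> the last inequality. Applied to a
  minimal functional it forces oddness; applied to the given one at \<open>e\<close> it prepares
  attainment at \<open>e\<close>.\<close>

lemma sublinear_on_shrink:
  assumes q: "sublinear_on s X q" and a: "a \<in> X"
  shows "\<exists>q'. sublinear_on s X q' \<and> q' \<le> q \<and> q' (- a) \<le> - q a"
proof -
  note qD = sublinear_onD[OF q]
  define h where "h x t = q (x + s t a) - t * q a" for x t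
  define q' where "q' x = (if x \<in> X then INF t\<in>{0..}. h x t else 0)" for x
  \<comment> \<open>Subadditivity applied to t a = (x + t a) + (- x); the bound does not depend on
    \<open>t\<close>, so the infimum is finite.\<close>
  have lower: "- q (- x) \<le> h x t" if "x \<in> X" "0 \<le> t" for x t
    using qD(1)[of "x + s t a" "- x"] qD(2)[OF a that(2)] that a by (simp add: h_def)
  have bdd: "bdd_below (h x ` {0..})" if "x \<in> X" for x
    using lower[OF that] by (intro bdd_belowI2) auto
  have le: "q' x \<le> h x t" if "x \<in> X" "0 \<le> t" for x t
    using that bdd by (auto simp: q'_def intro!: cINF_lower)
  have ge: "b \<le> q' x" if "x \<in> X" "\<And>t. 0 \<le> t \<Longrightarrow> b \<le> h x t" for x b
    using that by (auto simp: q'_def intro!: cINF_greatest)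
  have "sublinear_on s X q'"
  proof (rule sublinear_onI)
    fix x y assume xy: "x \<in> X" "y \<in> X"
    have "q' (x + y) \<le> h x t + h y r" if tr: "0 \<le> t" "0 \<le> r" for t r
    proof -
      have "q' (x + y) \<le> h (x + y) (t + r)" using xy tr by (intro le) auto
      also have "\<dots> \<le> h x t + h y r"
        using qD(1)[of "x + s t a" "y + s r a"] xy a
        by (simp add: h_def scale_left_distrib algebra_simps)
      finally show ?thesis .
    qed
    then have "q' (x + y) - h y r \<le> q' x" if "0 \<le> r" for r
      using that by (intro ge xy) (simp add: diff_le_eq)
    then have "q' (x + y) - q' x \<le> q' y"
      by (intro ge xy) (simp add: diff_le_eq add.commute)
    then show "q' (x + y) \<le> q' x + q' y" by simp
  next
    fix x t assume x: "x \<in> X" and t: "(0::real) < t"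
    have "q' (s t x) / t \<le> q' x"
    proof (rule ge[OF x])
      fix r assume r: "(0::real) \<le> r"
      have "q' (s t x) \<le> h (s t x) (t * r)" using x t r by (intro le) auto
      also have "\<dots> = t * h x r"
        using qD(2)[of "x + s r a" t] x a t
        by (simp add: h_def scale_right_distrib algebra_simps)
      finally show "q' (s t x) / t \<le> h x r" using t by (simp add: field_simps)
    qed
    then show "q' (s t x) \<le> t * q' x" using t by (simp add: field_simps)
  next
    have "h 0 t = 0" if "0 \<le> t" for t using qD(2)[OF a that] by (simp add: h_def)
    then have "h 0 ` {0..} = {0}" by (auto simp: image_iff intro: exI[of _ 0])
    then show "q' 0 = 0" by (simp add: q'_def)
  qed (simp add: q'_def)
  moreover have "q' x \<le> q x" for x
    using le[of x 0] qD(3)[of x] by (cases "x \<in> X") (auto simp: h_def q'_def)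
  moreover have "q' (- a) \<le> - q a"
    using le[of "- a" 1] a by (simp add: h_def sublinear_on_zero[OF q])
  ultimately show ?thesis by (auto simp: le_fun_def)
qed

text \<open>Zorn's lemma for the reversed order: the pointwise infimum of a nonempty chain is again
  sublinear.\<close>

lemma minimal_sublinear_on:
  assumes p: "sublinear_on s X p"
  shows "\<exists>m. sublinear_on s X m \<and> m \<le> p \<and> (\<forall>q. sublinear_on s X q \<and> q \<le> m \<longrightarrow> q = m)"
proof -
  define A where "A = {q. sublinear_on s X q \<and> q \<le> p}"
  have "\<exists>m\<in>A. \<forall>q\<in>A. m \<ge> q \<longrightarrow> q = m"
  proof (rule predicate_Zorn)
    show "partial_order_on A (relation_of (\<ge>) A)"
      by (rule partial_order_on_relation_ofI) auto
  next
    fix C assume C: "C \<in> Chains (relation_of (\<ge>) A)"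
    have CA: "C \<subseteq> A" using Chains_relation_of[OF C] .
    have chain: "q \<le> r \<or> r \<le> q" if "q \<in> C" "r \<in> C" for q r
      using C that by (auto simp: Chains_def relation_of_def)
    show "\<exists>u\<in>A. \<forall>q\<in>C. u \<le> q"
    proof (cases "C = {}")
      case True
      with p show ?thesis by (auto simp: A_def)
    next
      case False
      then obtain q0 where q0: "q0 \<in> C" by blast
      define u where "u x = (INF q\<in>C. q x)" for x
      \<comment> \<open>From - p(-x) \<le> - q(-x) \<le> q(x); the lower bound is the same for the
        whole chain, so the pointwise infimum is finite.\<close>
      have lower: "- p (- x) \<le> q x" if "q \<in> C" "x \<in> X" for q x
        using sublinear_on_neg[of q x] that CA unfolding A_def le_fun_def
        by (metis (mono_tags, lifting) le_minus_iff mem_Collect_eq minus_le_iff order_trans subsetD)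
      have sl: "sublinear_on s X q" if "q \<in> C" for q using that CA by (auto simp: A_def)
      have out: "u x = 0" if "x \<notin> X" for x
      proof -
        have "(\<lambda>q. q x) ` C = {0}" using sublinear_onD(3)[OF sl that] False by force
        then show ?thesis by (simp add: u_def)
      qed
      have le: "u x \<le> q x" if "q \<in> C" for q x
      proof (cases "x \<in> X")
        case True
        then show ?thesis unfolding u_def
          using lower that by (intro cINF_lower bdd_belowI2[of _ "- p (- x)"]) auto
      qed (simp add: out sublinear_onD(3)[OF sl[OF that]])
      have ge: "b \<le> u x" if "\<And>q. q \<in> C \<Longrightarrow> b \<le> q x" for x b
        unfolding u_def using that False by (intro cINF_greatest) auto
      have "sublinear_on s X u"
      proof (rule sublinear_onI)
        fix x y assume xy: "x \<in> X" "y \<in> X"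
        \<comment> \<open>Different members of the chain may nearly attain the two infima; the
          smaller one of them serves for both arguments.\<close>
        have "u (x + y) \<le> q x + r y" if qr: "q \<in> C" "r \<in> C" for q r
        proof -
          obtain z where z: "z \<in> C" "z \<le> q" "z \<le> r" using chain[OF qr] qr by blast
          have "u (x + y) \<le> z (x + y)" by (rule le[OF z(1)])
          also have "\<dots> \<le> z x + z y" by (rule sublinear_onD(1)[OF sl[OF z(1)] xy])
          also have "\<dots> \<le> q x + r y" using z(2,3) by (auto simp: le_fun_def intro: add_mono)
          finally show ?thesis .
        qed
        then have "u (x + y) - r y \<le> u x" if "r \<in> C" for r
          using that by (intro ge) (simp add: diff_le_eq)
        then have "u (x + y) - u x \<le> u y"
          by (intro ge) (simp add: diff_le_eq add.commute)
        then show "u (x + y) \<le> u x + u y" by simp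
      next
        fix x t assume x: "x \<in> X" and t: "(0::real) < t"
        have "u (s t x) / t \<le> u x"
          using le[of _ "s t x"] sublinear_onD(2)[OF sl x, of _ t] t
          by (intro ge) (simp add: field_simps)
        then show "u (s t x) \<le> t * u x" using t by (simp add: field_simps)
      next
        have "(\<lambda>q. q 0) ` C = {0}" using sublinear_on_zero[OF sl] False by force
        then show "u 0 = 0" by (simp add: u_def)
      qed (rule out)
      moreover have "u \<le> p" using le[OF q0] q0 CA by (force simp: A_def le_fun_def intro: order_trans)
      ultimately have "u \<in> A" by (simp add: A_def)
      with le show ?thesis by (auto simp: le_fun_def)
    qed
  qed
  then show ?thesis unfolding A_def by (blast intro: order_trans)
qed

text \<open>A minimal sublinear functional is odd, since shrinking cannot change it, and an odd
  sublinear functional is linear. Shrinking \<open>p\<close> at \<open>e\<close> beforehand gives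
  f(-e) \<le> - p(e), hence equality at \<open>e\<close>.\<close>

lemma hahn_banach_sublinear:
  assumes p: "sublinear_on s X p" and e: "e \<in> X"
  shows "\<exists>f. (\<forall>x\<in>X. \<forall>y\<in>X. f (x + y) = f x + f y) \<and> (\<forall>x\<in>X. \<forall>t. f (s t x) = t * f x) \<and>
    (\<forall>x\<in>X. f x \<le> p x) \<and> f e = p e"
proof -
  obtain p' where p': "sublinear_on s X p'" "p' \<le> p" "p' (- e) \<le> - p e"
    using sublinear_on_shrink[OF p e] by blast
  obtain m where m: "sublinear_on s X m" "m \<le> p'"
    and min: "\<And>q. sublinear_on s X q \<Longrightarrow> q \<le> m \<Longrightarrow> q = m"
    using minimal_sublinear_on[OF p'(1)] by blast
  have odd: "m (- x) = - m x" if x: "x \<in> X" for x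
  proof -
    obtain q where "sublinear_on s X q" "q \<le> m" "q (- x) \<le> - m x"
      using sublinear_on_shrink[OF m(1) x] by blast
    with min have "m (- x) \<le> - m x" by blast
    with sublinear_on_neg[OF m(1) x] show ?thesis by simp
  qed
  have add: "m (x + y) = m x + m y" if "x \<in> X" "y \<in> X" for x y
    using sublinear_onD(1)[OF m(1), of "x + y" "- y"] sublinear_onD(1)[OF m(1) that] that
    by (simp add: odd)
  have scale: "m (s t x) = t * m x" if "x \<in> X" for x t
  proof (cases "0 \<le> t")
    case False
    then have "m (s (- t) x) = - t * m x" using that by (intro sublinear_onD(2)[OF m(1)]) auto
    with odd[of "s t x"] that show ?thesis by simp
  qed (use that sublinear_onD(2)[OF m(1)] in auto)
  have le: "m x \<le> p x" for x using m(2) p'(2) by (meson le_fun_def order_trans)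
  have "m (- e) \<le> - p e" using m(2) p'(3) by (meson le_fun_def order_trans)
  with odd[OF e] le[of e] have "m e = p e" by simp
  with add scale le show ?thesis by blast
qed

end

section \<open>Domination by seminorms\<close>

locale seminormed_space =
  fixes V :: "('k::real_or_complex, 'v::ab_group_add) lcs"
  assumes vector_space: "vector_space (scl V)"
    and subspace: "module.subspace (scl V) (vcar V)"
    and seminorm: "q \<in> snorms V \<Longrightarrow> seminorm_on V q"
begin

sublocale vector_space "scl V"
  by (rule vector_space)

lemma carrier [simp]:
  "0 \<in> vcar V"
  "v \<in> vcar V \<Longrightarrow> w \<in> vcar V \<Longrightarrow> v + w \<in> vcar V"
  "v \<in> vcar V \<Longrightarrow> w \<in> vcar V \<Longrightarrow> v - w \<in> vcar V"
  "v \<in> vcar V \<Longrightarrow> scl V c v \<in> vcar V"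
  "v \<in> vcar V \<Longrightarrow> - v \<in> vcar V"
  by (auto intro: subspace_0 subspace_add subspace_diff subspace_scale subspace_neg subspace)

lemma snorm_nonneg: "q \<in> snorms V \<Longrightarrow> v \<in> vcar V \<Longrightarrow> 0 \<le> q v"
  and snorm_add: "q \<in> snorms V \<Longrightarrow> v \<in> vcar V \<Longrightarrow> w \<in> vcar V \<Longrightarrow> q (v + w) \<le> q v + q w"
  and snorm_scale: "q \<in> snorms V \<Longrightarrow> v \<in> vcar V \<Longrightarrow> q (scl V c v) = norm c * q v"
  using seminorm unfolding seminorm_on_def by blast+

lemma snorm_zero: "q \<in> snorms V \<Longrightarrow> q 0 = 0"
  using snorm_scale[of q 0 0] by simp

lemma snorm_minus: "q \<in> snorms V \<Longrightarrow> v \<in> vcar V \<Longrightarrow> q (- v) = q v"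
  using snorm_scale[of q v "- 1"] by simp

lemma snorm_diff_commute:
  "q \<in> snorms V \<Longrightarrow> v \<in> vcar V \<Longrightarrow> w \<in> vcar V \<Longrightarrow> q (v - w) = q (w - v)"
  using snorm_minus[of q "v - w"] by simp

lemma snorm_triangle:
  "q \<in> snorms V \<Longrightarrow> u \<in> vcar V \<Longrightarrow> v \<in> vcar V \<Longrightarrow> w \<in> vcar V \<Longrightarrow> q (u - w) \<le> q (u - v) + q (v - w)"
  using snorm_add[of q "u - v" "v - w"] by simp

lemma snorm_diff_le:
  "q \<in> snorms V \<Longrightarrow> v \<in> vcar V \<Longrightarrow> w \<in> vcar V \<Longrightarrow> q v - q w \<le> q (v - w)"
  using snorm_add[of q "v - w" w] by simp

definition ball :: "'v \<Rightarrow> ('v \<Rightarrow> real) set \<Rightarrow> real \<Rightarrow> 'v set" where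
  "ball v Q r = {w \<in> vcar V. \<forall>q\<in>Q. q (w - v) < r}"

lemma openin_iff_ball:
  "openin (lcs_top V) U \<longleftrightarrow> U \<subseteq> vcar V \<and>
     (\<forall>v\<in>U. \<exists>Q r. finite Q \<and> Q \<subseteq> snorms V \<and> 0 < r \<and> ball v Q r \<subseteq> U)"
  by (simp add: openin_lcs_top lcs_open_def ball_def)

lemma centre_in_ball: "v \<in> vcar V \<Longrightarrow> Q \<subseteq> snorms V \<Longrightarrow> 0 < r \<Longrightarrow> v \<in> ball v Q r"
  by (auto simp: ball_def snorm_zero)

lemma openin_ball:
  assumes v: "v \<in> vcar V" and Q: "finite Q" "Q \<subseteq> snorms V"
  shows "openin (lcs_top V) (ball v Q r)"
  unfolding openin_iff_ball
proof (intro conjI ballI)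
  fix w assume w: "w \<in> ball v Q r"
  \<comment> \<open>The element 1 keeps the minimum meaningful when \<open>Q\<close> is
    empty.\<close>
  define \<rho> where "\<rho> = Min (insert 1 ((\<lambda>q. r - q (w - v)) ` Q))"
  have "\<rho> > 0" using w Q(1) by (auto simp: \<rho>_def ball_def)
  moreover have "ball w Q \<rho> \<subseteq> ball v Q r"
  proof
    fix x assume x: "x \<in> ball w Q \<rho>"
    have "q (x - v) < r" if q: "q \<in> Q" for q
    proof -
      have "q (x - w) < \<rho>" using x q by (simp add: ball_def)
      also have "\<rho> \<le> r - q (w - v)" using Q(1) q by (simp add: \<rho>_def)
      finally show ?thesis
        using snorm_triangle[of q x w v] q Q(2) x w v by (auto simp: ball_def)
    qed
    with x show "x \<in> ball v Q r" by (simp add: ball_def)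
  qed
  ultimately show "\<exists>Q' r'. finite Q' \<and> Q' \<subseteq> snorms V \<and> 0 < r' \<and> ball w Q' r' \<subseteq> ball v Q r"
    using Q by blast
qed (auto simp: ball_def)

text \<open>Continuity, equicontinuity and boundedness all reduce to domination by finitely many seminorms.\<close>

definition dominated :: "('v \<Rightarrow> real) \<Rightarrow> bool" where
  "dominated g \<longleftrightarrow> (\<exists>Q C. finite Q \<and> Q \<subseteq> snorms V \<and> 0 \<le> C \<and> (\<forall>v\<in>vcar V. g v \<le> C * (\<Sum>q\<in>Q. q v)))"

lemma dominatedI:
  "finite Q \<Longrightarrow> Q \<subseteq> snorms V \<Longrightarrow> 0 \<le> C \<Longrightarrow> (\<And>v. v \<in> vcar V \<Longrightarrow> g v \<le> C * (\<Sum>q\<in>Q. q v)) \<Longrightarrow> dominated g"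
  unfolding dominated_def by blast

lemma dominatedE:
  assumes "dominated g"
  obtains Q C where "finite Q" "Q \<subseteq> snorms V" "0 \<le> C" "\<And>v. v \<in> vcar V \<Longrightarrow> g v \<le> C * (\<Sum>q\<in>Q. q v)"
  using assms unfolding dominated_def by blast

lemma dominated_mono: "dominated g \<Longrightarrow> (\<And>v. v \<in> vcar V \<Longrightarrow> f v \<le> g v) \<Longrightarrow> dominated f"
  unfolding dominated_def by (meson order_trans)

lemma dominated_snorm: "q \<in> snorms V \<Longrightarrow> dominated q"
  by (rule dominatedI[of "{q}" 1]) auto

lemma dominated_zero: "dominated (\<lambda>v. 0)"
  by (rule dominatedI[of "{}" 0]) auto

lemma dominated_scale: "dominated g \<Longrightarrow> 0 \<le> c \<Longrightarrow> dominated (\<lambda>v. c * g v)"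
  by (erule dominatedE, rule dominatedI[where C = "c * _"]) (auto simp: mult.assoc intro: mult_left_mono)

lemma dominated_add:
  assumes "dominated f" "dominated g"
  shows "dominated (\<lambda>v. f v + g v)"
proof -
  obtain Q C where f: "finite Q" "Q \<subseteq> snorms V" "0 \<le> C" "\<And>v. v \<in> vcar V \<Longrightarrow> f v \<le> C * (\<Sum>q\<in>Q. q v)"
    using assms(1) dominatedE by blast
  obtain R D where g: "finite R" "R \<subseteq> snorms V" "0 \<le> D" "\<And>v. v \<in> vcar V \<Longrightarrow> g v \<le> D * (\<Sum>q\<in>R. q v)"
    using assms(2) dominatedE by blast
  show ?thesis
  proof (rule dominatedI[of "Q \<union> R" "C + D"])
    fix v assume v: "v \<in> vcar V"
    have "(\<Sum>q\<in>Q. q v) \<le> (\<Sum>q\<in>Q\<union>R. q v)" "(\<Sum>q\<in>R. q v) \<le> (\<Sum>q\<in>Q\<union>R. q v)"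
      using f g v by (auto intro!: sum_mono2 snorm_nonneg)
    then have "C * (\<Sum>q\<in>Q. q v) + D * (\<Sum>q\<in>R. q v) \<le> C * (\<Sum>q\<in>Q\<union>R. q v) + D * (\<Sum>q\<in>Q\<union>R. q v)"
      using f(3) g(3) by (intro add_mono mult_left_mono)
    with f(4)[OF v] g(4)[OF v] show "f v + g v \<le> (C + D) * (\<Sum>q\<in>Q\<union>R. q v)"
      by (simp add: distrib_right)
  qed (use f g in auto)
qed

lemma dominated_sum:
  "finite I \<Longrightarrow> (\<And>i. i \<in> I \<Longrightarrow> dominated (g i)) \<Longrightarrow> dominated (\<lambda>v. \<Sum>i\<in>I. g i v)"
  by (induction I rule: finite_induct) (simp_all add: dominated_zero dominated_add)

lemma dominated_neighbourhood:
  assumes g: "dominated g" and v: "v \<in> vcar V" and \<epsilon>: "0 < \<epsilon>"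
  obtains U where "openin (lcs_top V) U" "v \<in> U" "\<And>w. w \<in> U \<Longrightarrow> g (w - v) < \<epsilon>"
proof -
  obtain Q C where Q: "finite Q" "Q \<subseteq> snorms V" "0 \<le> C" "\<And>v. v \<in> vcar V \<Longrightarrow> g v \<le> C * (\<Sum>q\<in>Q. q v)"
    using g dominatedE by blast
  \<comment> \<open>Adding 1 to \<open>C\<close> and to \<open>card Q\<close> keeps the denominator
    positive and the final inequality strict even when \<open>C\<close> is 0 or \<open>Q\<close> is
    empty.\<close>
  define r where "r = \<epsilon> / ((C + 1) * (card Q + 1))"
  have r: "r > 0" using \<epsilon> Q(3) by (simp add: r_def)
  have "g (w - v) < \<epsilon>" if w: "w \<in> ball v Q r" for w
  proof -
    have "g (w - v) \<le> C * (\<Sum>q\<in>Q. q (w - v))" using w v by (intro Q(4)) (simp add: ball_def)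
    also have "\<dots> \<le> C * (\<Sum>q\<in>Q. r)"
      using w Q(3) by (intro mult_left_mono sum_mono) (auto simp: ball_def less_imp_le)
    also have "\<dots> = (C * card Q) * r" by simp
    also have "\<dots> < ((C + 1) * (card Q + 1)) * r"
      using r Q(3) by (intro mult_strict_right_mono) (simp_all add: algebra_simps)
    also have "\<dots> = \<epsilon>"
    proof -
      have "(C + 1) * (card Q + 1) > 0" using Q(3) by (intro mult_pos_pos) auto
      then show ?thesis unfolding r_def by (metis less_irrefl nonzero_mult_div_cancel_left times_divide_eq_right)
    qed
    finally show ?thesis .
  qed
  then show thesis
    using that[of "ball v Q r"] openin_ball[OF v Q(1,2)] centre_in_ball[OF v Q(2) r] by blast
qed

text \<open>The dominating function is obtained before \<open>g\<close> is chosen, so one and the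
  same \<open>h\<close> serves for a whole equicontinuous family.\<close>

lemma dominated_if_bounded_near_zero:
  assumes U: "openin (lcs_top V) U" "0 \<in> U"
  obtains h where "dominated h"
    "\<And>g v. (\<And>w. w \<in> U \<Longrightarrow> g w \<le> 1) \<Longrightarrow>
      (\<And>w c. w \<in> vcar V \<Longrightarrow> 0 < c \<Longrightarrow> g (scl V (of_real c) w) = c * g w) \<Longrightarrow>
      v \<in> vcar V \<Longrightarrow> g v \<le> h v"
proof -
  obtain Q r where Q: "finite Q" "Q \<subseteq> snorms V" "0 < r" "ball 0 Q r \<subseteq> U"
    using U unfolding openin_iff_ball by blast
  have "g v \<le> (1 / r) * (\<Sum>q\<in>Q. q v)" if bound: "\<And>w. w \<in> U \<Longrightarrow> g w \<le> 1"
      and hom: "\<And>w c. w \<in> vcar V \<Longrightarrow> 0 < c \<Longrightarrow> g (scl V (of_real c) w) = c * g w"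
      and v: "v \<in> vcar V" for g v
  proof (rule field_le_epsilon)
    fix \<delta> :: real assume \<delta>: "0 < \<delta>"
    \<comment> \<open>Scaling \<open>v\<close> by r / t moves it into the ball. The slack
      \<open>r * \<delta>\<close> keeps \<open>t\<close> positive when all seminorms in
      \<open>Q\<close> vanish at \<open>v\<close>, and costs exactly \<open>\<delta>\<close> in the
      conclusion.\<close>
    define t where "t = (\<Sum>q\<in>Q. q v) + r * \<delta>"
    have s0: "0 \<le> (\<Sum>q\<in>Q. q v)" using Q v by (auto intro: sum_nonneg snorm_nonneg)
    have t: "t > 0" using \<delta> Q(3) s0 by (simp add: t_def add_nonneg_pos)
    have "q (scl V (of_real (r / t)) v) < r" if q: "q \<in> Q" for q
    proof -
      have "q v \<le> (\<Sum>q\<in>Q. q v)"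
        using Q q v by (intro member_le_sum) (auto intro: snorm_nonneg)
      also have "\<dots> < t" using \<delta> Q(3) by (simp add: t_def)
      finally have "q v < t" .
      moreover have "q (scl V (of_real (r / t)) v) = (r / t) * q v"
        using snorm_scale[of q v "of_real (r / t)"] q Q(2,3) v t by (auto simp: norm_divide)
      ultimately show ?thesis using t Q(3) by (simp add: pos_divide_less_eq mult.commute del: of_real_divide)
    qed
    then have "scl V (of_real (r / t)) v \<in> ball 0 Q r" using v by (simp add: ball_def)
    then have "g (scl V (of_real (r / t)) v) \<le> 1" using Q(4) bound by blast
    then have "(r / t) * g v \<le> 1" using hom[OF v, of "r / t"] Q(3) t by simp
    then show "g v \<le> (1 / r) * (\<Sum>q\<in>Q. q v) + \<delta>"
      using t Q(3) by (simp add: field_simps t_def)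
  qed
  moreover have "dominated (\<lambda>v. (1 / r) * (\<Sum>q\<in>Q. q v))"
    using Q(1-3) by (intro dominatedI[of Q "1 / r"]) auto
  ultimately show thesis using that by blast
qed

lemma continuous_map_euclidean_if_dominated:
  fixes f :: "'v \<Rightarrow> 'r::metric_space"
  assumes g: "dominated g"
    and fg: "\<And>v w. v \<in> vcar V \<Longrightarrow> w \<in> vcar V \<Longrightarrow> dist (f v) (f w) \<le> g (w - v)"
  shows "continuous_map (lcs_top V) euclidean f"
  unfolding continuous_map_def
proof (intro conjI allI impI)
  fix T :: "'r set" assume "openin euclidean T"
  then have T: "open T" by simp
  show "openin (lcs_top V) {v \<in> topspace (lcs_top V). f v \<in> T}"
  proof (subst openin_subopen, intro ballI)
    fix v assume "v \<in> {v \<in> topspace (lcs_top V). f v \<in> T}"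
    then have v: "v \<in> vcar V" "f v \<in> T" by auto
    obtain \<epsilon> where \<epsilon>: "\<epsilon> > 0" "\<And>z. dist z (f v) < \<epsilon> \<Longrightarrow> z \<in> T"
      using T v(2) unfolding open_dist by blast
    obtain U where U: "openin (lcs_top V) U" "v \<in> U" "\<And>w. w \<in> U \<Longrightarrow> g (w - v) < \<epsilon>"
      using dominated_neighbourhood[OF g v(1) \<epsilon>(1)] by blast
    have "w \<in> vcar V \<and> f w \<in> T" if "w \<in> U" for w
    proof -
      have w: "w \<in> vcar V" using U(1) that openin_subset by fastforce
      then have "dist (f v) (f w) < \<epsilon>" using fg[OF v(1) w] U(3)[OF that] by simp
      with \<epsilon>(2) w show ?thesis by (simp add: dist_commute)
    qed
    with U(1,2) show "\<exists>U. openin (lcs_top V) U \<and> v \<in> U \<and> U \<subseteq> {v \<in> topspace (lcs_top V). f v \<in> T}"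
      by (intro exI[of _ U]) auto
  qed
qed simp

lemma continuous_map_snorm:
  assumes q: "q \<in> snorms V" shows "continuous_map (lcs_top V) euclideanreal q"
proof (rule continuous_map_euclidean_if_dominated[OF dominated_snorm[OF q]])
  fix v w assume "v \<in> vcar V" "w \<in> vcar V"
  then show "dist (q v) (q w) \<le> q (w - v)"
    using snorm_diff_le[OF q, of v w] snorm_diff_le[OF q, of w v] snorm_diff_commute[OF q, of v w]
    by (auto simp: dist_real_def)
qed

text \<open>The function \<open>g\<close> may be discontinuous, but the multiple of a finite sum of
  seminorms above it is continuous and hence bounded on \<open>K\<close>.\<close>

lemma dominated_bounded_on_compact:
  assumes g: "dominated g" and K: "compactin (lcs_top V) K"
  shows "\<exists>b. \<forall>v\<in>K. g v \<le> b"
proof -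
  obtain Q C where Q: "finite Q" "Q \<subseteq> snorms V" "0 \<le> C" "\<And>v. v \<in> vcar V \<Longrightarrow> g v \<le> C * (\<Sum>q\<in>Q. q v)"
    using g dominatedE by blast
  have "continuous_map (lcs_top V) euclideanreal (\<lambda>v. C * (\<Sum>q\<in>Q. q v))"
    using Q(1,2) by (intro continuous_map_real_mult_left continuous_map_sum continuous_map_snorm) auto
  with K have "compact ((\<lambda>v. C * (\<Sum>q\<in>Q. q v)) ` K)"
    by (metis image_compactin compactin_euclidean_iff)
  then have "bdd_above ((\<lambda>v. C * (\<Sum>q\<in>Q. q v)) ` K)"
    by (intro bounded_imp_bdd_above compact_imp_bounded)
  then obtain b where "\<And>v. v \<in> K \<Longrightarrow> C * (\<Sum>q\<in>Q. q v) \<le> b"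
    unfolding bdd_above_def by blast
  moreover have "K \<subseteq> vcar V" using compactin_subset_topspace[OF K] by simp
  ultimately show ?thesis using Q(4) by (meson order_trans subsetD)
qed

lemma continuous_map_plus:
  "continuous_map (prod_topology (lcs_top V) (lcs_top V)) (lcs_top V) (\<lambda>(v, w). v + w)"
  unfolding continuous_map_def
proof (intro conjI allI impI)
  fix T assume T: "openin (lcs_top V) T"
  let ?P = "{x \<in> topspace (prod_topology (lcs_top V) (lcs_top V)). (case x of (v, w) \<Rightarrow> v + w) \<in> T}"
  show "openin (prod_topology (lcs_top V) (lcs_top V)) ?P"
    unfolding openin_prod_topology_alt
  proof (intro allI impI)
    fix v w assume "(v, w) \<in> ?P"
    then have vw: "v \<in> vcar V" "w \<in> vcar V" "v + w \<in> T" by auto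
    obtain Q r where Q: "finite Q" "Q \<subseteq> snorms V" "0 < r" "ball (v + w) Q r \<subseteq> T"
      using T vw(3) unfolding openin_iff_ball by blast
    have "(v', w') \<in> ?P" if v': "v' \<in> ball v Q (r / 2)" and w': "w' \<in> ball w Q (r / 2)" for v' w'
    proof -
      have "q (v' + w' - (v + w)) < r" if q: "q \<in> Q" for q
      proof -
        have "q ((v' - v) + (w' - w)) \<le> q (v' - v) + q (w' - w)"
          using q Q(2) v' w' vw by (intro snorm_add) (auto simp: ball_def)
        also have "\<dots> < r / 2 + r / 2"
          using q v' w' by (intro add_strict_mono) (auto simp: ball_def)
        finally show ?thesis by (simp add: algebra_simps)
      qed
      with v' w' Q(4) show ?thesis by (auto simp: ball_def subset_iff)
    qed
    then show "\<exists>U W. openin (lcs_top V) U \<and> openin (lcs_top V) W \<and> v \<in> U \<and> w \<in> W \<and> U \<times> W \<subseteq> ?P"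
      using vw Q openin_ball centre_in_ball
      by (intro exI[of _ "ball v Q (r / 2)"] exI[of _ "ball w Q (r / 2)"]) (auto simp del: topspace_prod_topology)
  qed
qed auto

lemma compactin_plus:
  assumes K: "compactin (lcs_top V) K" and L: "compactin (lcs_top V) L"
  shows "compactin (lcs_top V) {v + w | v w. v \<in> K \<and> w \<in> L}"
proof -
  have "compactin (prod_topology (lcs_top V) (lcs_top V)) (K \<times> L)"
    using K L by (simp add: compactin_Times)
  then have "compactin (lcs_top V) ((\<lambda>(v, w). v + w) ` (K \<times> L))"
    using continuous_map_plus by (rule image_compactin)
  moreover have "(\<lambda>(v, w). v + w) ` (K \<times> L) = {v + w | v w. v \<in> K \<and> w \<in> L}" by auto
  ultimately show ?thesis by simp
qed

end

section \<open>Continuous linear maps\<close>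

lemma vector_space_pw_scl:
  assumes "vector_space (scl W)" shows "vector_space (pw_scl W)"
proof -
  interpret vector_space "scl W" by (rule assms)
  show ?thesis
    by standard (auto simp: pw_scl_def fun_eq_iff scale_right_distrib scale_left_distrib)
qed

lemma seminormed_space_scalars: "seminormed_space (scalars :: ('k::real_or_complex, 'k) lcs)"
proof (rule seminormed_space.intro)
  show "vector_space (scl (scalars :: ('k, 'k) lcs))"
    by standard (auto simp: scalars_def algebra_simps)
  then interpret vector_space "scl (scalars :: ('k, 'k) lcs)" .
  show "subspace (vcar (scalars :: ('k, 'k) lcs))" by (simp add: scalars_def)
  show "q \<in> snorms (scalars :: ('k, 'k) lcs) \<Longrightarrow> seminorm_on scalars q" for q
    by (auto simp: scalars_def seminorm_on_def norm_triangle_ineq norm_mult)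
qed

interpretation scalars: seminormed_space "scalars :: ('k::real_or_complex, 'k) lcs"
  by (rule seminormed_space_scalars)

lemma scalars_simps [simp]:
  "vcar scalars = UNIV" "scl scalars = (*)" "snorms scalars = {norm}"
  by (simp_all add: scalars_def)

locale seminormed_space_pair = V: seminormed_space V + W: seminormed_space W
  for V :: "('k::real_or_complex, 'v::ab_group_add) lcs"
    and W :: "('k, 'w::ab_group_add) lcs"
begin

lemma linear_onD:
  assumes "linear_on V W u"
  shows "v \<in> vcar V \<Longrightarrow> u v \<in> vcar W"
    "v \<in> vcar V \<Longrightarrow> w \<in> vcar V \<Longrightarrow> u (v + w) = u v + u w"
    "v \<in> vcar V \<Longrightarrow> u (scl V c v) = scl W c (u v)"
  using assms unfolding linear_on_def by blast+

lemma linear_on_diff: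
  assumes u: "linear_on V W u" and "v \<in> vcar V" "w \<in> vcar V"
  shows "u (v - w) = u v - u w"
  using linear_onD(2)[OF u, of "v - w" w] assms by simp

lemma linear_on_zero: "linear_on V W u \<Longrightarrow> u 0 = 0"
  using linear_on_diff[of u 0 0] by simp

lemma continuous_map_iff_dominated:
  assumes u: "linear_on V W u"
  shows "continuous_map (lcs_top V) (lcs_top W) u \<longleftrightarrow> (\<forall>p\<in>snorms W. V.dominated (\<lambda>v. p (u v)))"
proof
  assume c: "continuous_map (lcs_top V) (lcs_top W) u"
  show "\<forall>p\<in>snorms W. V.dominated (\<lambda>v. p (u v))"
  proof
    fix p assume p: "p \<in> snorms W"
    let ?U = "{v \<in> topspace (lcs_top V). u v \<in> W.ball 0 {p} 1}"
    have "openin (lcs_top V) ?U"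
      by (rule openin_continuous_map_preimage[OF c W.openin_ball]) (use p in auto)
    moreover have "0 \<in> ?U" using p W.centre_in_ball[of 0 "{p}" 1] by (simp add: linear_on_zero[OF u])
    ultimately obtain h where h: "V.dominated h"
      "\<And>g v. (\<And>w. w \<in> ?U \<Longrightarrow> g w \<le> 1) \<Longrightarrow>
        (\<And>w c. w \<in> vcar V \<Longrightarrow> 0 < c \<Longrightarrow> g (scl V (of_real c) w) = c * g w) \<Longrightarrow>
        v \<in> vcar V \<Longrightarrow> g v \<le> h v"
      by (rule V.dominated_if_bounded_near_zero) blast
    show "V.dominated (\<lambda>v. p (u v))"
    proof (rule V.dominated_mono[OF h(1)], rule h(2))
      fix v assume "v \<in> ?U"
      then show "p (u v) \<le> 1" by (simp add: W.ball_def)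
    next
      fix v and c :: real assume "v \<in> vcar V" "0 < c"
      then show "p (u (scl V (of_real c) v)) = c * p (u v)"
        using W.snorm_scale[OF p, of "u v" "of_real c"] by (simp add: linear_onD[OF u])
    qed
  qed
next
  assume dom: "\<forall>p\<in>snorms W. V.dominated (\<lambda>v. p (u v))"
  show "continuous_map (lcs_top V) (lcs_top W) u"
    unfolding continuous_map_def
  proof (intro conjI allI impI)
    fix T assume T: "openin (lcs_top W) T"
    show "openin (lcs_top V) {v \<in> topspace (lcs_top V). u v \<in> T}"
    proof (subst openin_subopen, intro ballI)
      fix v assume "v \<in> {v \<in> topspace (lcs_top V). u v \<in> T}"
      then have v: "v \<in> vcar V" "u v \<in> T" by auto
      obtain Q r where Q: "finite Q" "Q \<subseteq> snorms W" "0 < r" "W.ball (u v) Q r \<subseteq> T"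
        using T v(2) unfolding W.openin_iff_ball by blast
      have "V.dominated (\<lambda>v. \<Sum>q\<in>Q. q (u v))"
        using dom Q by (intro V.dominated_sum) auto
      then obtain U where U: "openin (lcs_top V) U" "v \<in> U"
        "\<And>w. w \<in> U \<Longrightarrow> (\<Sum>q\<in>Q. q (u (w - v))) < r"
        using V.dominated_neighbourhood v(1) Q(3) by blast
      have "w \<in> vcar V \<and> u w \<in> T" if "w \<in> U" for w
      proof -
        have w: "w \<in> vcar V" using U(1) that openin_subset by fastforce
        have "q (u w - u v) < r" if q: "q \<in> Q" for q
        proof -
          have "q (u (w - v)) \<le> (\<Sum>q\<in>Q. q (u (w - v)))"
            using Q q v w by (intro member_le_sum) (auto intro!: W.snorm_nonneg linear_onD(1)[OF u])
          with U(3)[OF \<open>w \<in> U\<close>] show ?thesis by (simp add: linear_on_diff[OF u w v(1)])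
        qed
        then have "u w \<in> W.ball (u v) Q r" using linear_onD(1)[OF u w] by (simp add: W.ball_def)
        with Q(4) w show ?thesis by blast
      qed
      with U(1,2) show "\<exists>U. openin (lcs_top V) U \<and> v \<in> U \<and> U \<subseteq> {v \<in> topspace (lcs_top V). u v \<in> T}"
        by (intro exI[of _ U]) auto
    qed
  qed (use linear_onD(1)[OF u] in auto)
qed

lemma cont_linear_maps_iff_dominated:
  "u \<in> cont_linear_maps V W \<longleftrightarrow> linear_on V W u \<and>
     (\<forall>p\<in>snorms W. V.dominated (\<lambda>v. p (u v))) \<and> (\<forall>v. v \<notin> vcar V \<longrightarrow> u v = 0)"
  using continuous_map_iff_dominated by (auto simp: cont_linear_maps_def)

text \<open>Serves for the dual, with the scalars as target, and for the carrier of the epsilon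
  product, with \<open>dual_kappa V\<close> as source.\<close>

lemma subspace_cont_linear_maps: "module.subspace (pw_scl W) (cont_linear_maps V W)"
proof -
  interpret pw: vector_space "pw_scl W" by (rule vector_space_pw_scl[OF W.vector_space])
  show ?thesis
    unfolding pw.subspace_def
  proof (intro conjI ballI allI)
    show "0 \<in> cont_linear_maps V W"
      by (auto simp: cont_linear_maps_iff_dominated linear_on_def W.snorm_zero V.dominated_zero)
  next
    fix u u' assume "u \<in> cont_linear_maps V W" "u' \<in> cont_linear_maps V W"
    then have u: "linear_on V W u" "linear_on V W u'"
      "\<And>p. p \<in> snorms W \<Longrightarrow> V.dominated (\<lambda>v. p (u v))"
      "\<And>p. p \<in> snorms W \<Longrightarrow> V.dominated (\<lambda>v. p (u' v))"
      "\<And>v. v \<notin> vcar V \<Longrightarrow> u v = 0" "\<And>v. v \<notin> vcar V \<Longrightarrow> u' v = 0"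
      by (auto simp: cont_linear_maps_iff_dominated)
    have "V.dominated (\<lambda>v. p ((u + u') v))" if p: "p \<in> snorms W" for p
      by (rule V.dominated_mono[OF V.dominated_add[OF u(3)[OF p] u(4)[OF p]]])
        (simp add: W.snorm_add p linear_onD(1)[OF u(1)] linear_onD(1)[OF u(2)])
    moreover have "linear_on V W (u + u')"
      using linear_onD[OF u(1)] linear_onD[OF u(2)]
      by (auto simp: linear_on_def W.scale_right_distrib)
    ultimately show "u + u' \<in> cont_linear_maps V W"
      using u(5,6) by (simp add: cont_linear_maps_iff_dominated)
  next
    fix c u assume "u \<in> cont_linear_maps V W"
    then have u: "linear_on V W u"
      "\<And>p. p \<in> snorms W \<Longrightarrow> V.dominated (\<lambda>v. p (u v))" "\<And>v. v \<notin> vcar V \<Longrightarrow> u v = 0"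
      by (auto simp: cont_linear_maps_iff_dominated)
    have "V.dominated (\<lambda>v. p (pw_scl W c u v))" if p: "p \<in> snorms W" for p
      by (rule V.dominated_mono[OF V.dominated_scale[OF u(2)[OF p] norm_ge_zero[of c]]])
        (simp add: pw_scl_def W.snorm_scale p linear_onD(1)[OF u(1)])
    moreover have "linear_on V W (pw_scl W c u)"
      using linear_onD[OF u(1)]
      by (auto simp: linear_on_def pw_scl_def W.scale_right_distrib mult.commute)
    ultimately show "pw_scl W c u \<in> cont_linear_maps V W"
      using u(3) by (simp add: cont_linear_maps_iff_dominated pw_scl_def)
  qed
qed

text \<open>The last assumption says that each seminorm of the source is controlled by the image; by
  linearity this holds for differences too, which makes the map open onto its range.\<close>

lemma iso_intoI:
  assumes u: "linear_on V W u" and inj: "\<And>v. v \<in> vcar V \<Longrightarrow> u v = 0 \<Longrightarrow> v = 0"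
    and cont: "\<And>p. p \<in> snorms W \<Longrightarrow> V.dominated (\<lambda>v. p (u v))"
    and inv: "\<And>q. q \<in> snorms V \<Longrightarrow> \<exists>g. W.dominated g \<and> (\<forall>v\<in>vcar V. q v \<le> g (u v))"
  shows "iso_into V W u"
proof -
  let ?R = "subtopology (lcs_top W) (u ` vcar V)"
  have inj_on: "inj_on u (vcar V)"
  proof (rule inj_onI)
    fix v w assume "v \<in> vcar V" "w \<in> vcar V" "u v = u w"
    then show "v = w" using inj[of "v - w"] by (simp add: linear_on_diff[OF u])
  qed
  have "continuous_map (lcs_top V) ?R u"
    using cont continuous_map_iff_dominated[OF u] by (auto simp: continuous_map_in_subtopology)
  moreover have "open_map (lcs_top V) ?R u"
    unfolding open_map_def
  proof (intro allI impI, subst openin_subopen, intro ballI)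
    fix U y assume U: "openin (lcs_top V) U" and "y \<in> u ` U"
    then obtain v where v: "v \<in> U" "y = u v" by blast
    have vV: "v \<in> vcar V" using U v(1) openin_subset by fastforce
    obtain Q r where Q: "finite Q" "Q \<subseteq> snorms V" "0 < r" "V.ball v Q r \<subseteq> U"
      using U v(1) unfolding V.openin_iff_ball by blast
    obtain g where g: "\<And>q. q \<in> Q \<Longrightarrow> W.dominated (g q)"
      "\<And>q v. q \<in> Q \<Longrightarrow> v \<in> vcar V \<Longrightarrow> q v \<le> g q (u v)"
      using inv Q(2) by (metis subsetD)
    \<comment> \<open>A dominated function may be negative; truncating at 0 lets the sum bound each
      of its terms.\<close>
    have "W.dominated (\<lambda>w. \<Sum>q\<in>Q. max (g q w) 0)"
    proof (rule W.dominated_sum[OF Q(1)])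
      fix q assume "q \<in> Q"
      then obtain R C where R: "finite R" "R \<subseteq> snorms W" "0 \<le> C"
        "\<And>w. w \<in> vcar W \<Longrightarrow> g q w \<le> C * (\<Sum>p\<in>R. p w)"
        using g(1) W.dominatedE by blast
      have "0 \<le> C * (\<Sum>p\<in>R. p w)" if "w \<in> vcar W" for w
        using R(2) that by (intro mult_nonneg_nonneg[OF R(3)] sum_nonneg) (auto intro: W.snorm_nonneg)
      with R show "W.dominated (\<lambda>w. max (g q w) 0)"
        by (intro W.dominatedI[of R C]) auto
    qed
    then obtain T where T: "openin (lcs_top W) T" "u v \<in> T"
      "\<And>w. w \<in> T \<Longrightarrow> (\<Sum>q\<in>Q. max (g q (w - u v)) 0) < r"
      using W.dominated_neighbourhood linear_onD(1)[OF u vV] Q(3) by blast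
    have "u w \<in> u ` U" if w: "w \<in> vcar V" "u w \<in> T" for w
    proof -
      have "q (w - v) < r" if q: "q \<in> Q" for q
      proof -
        have "q (w - v) \<le> max (g q (u w - u v)) 0"
          using g(2)[OF q, of "w - v"] w vV by (simp add: linear_on_diff[OF u] le_max_iff_disj)
        also have "\<dots> \<le> (\<Sum>q\<in>Q. max (g q (u w - u v)) 0)"
          using Q(1) q by (intro member_le_sum) auto
        also have "\<dots> < r" by (rule T(3)[OF w(2)])
        finally show ?thesis .
      qed
      then have "w \<in> V.ball v Q r" using w by (simp add: V.ball_def)
      with Q(4) show ?thesis by blast
    qed
    then have "u ` vcar V \<inter> T \<subseteq> u ` U" by blast
    moreover have "openin ?R (u ` vcar V \<inter> T)" using T(1) by (simp add: openin_subtopology_Int2)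
    ultimately show "\<exists>T. openin ?R T \<and> y \<in> T \<and> T \<subseteq> u ` U"
      using T(2) v(2) vV by blast
  qed
  moreover have "topspace ?R = u ` vcar V" using linear_onD(1)[OF u] by auto
  ultimately have "homeomorphic_map (lcs_top V) ?R u"
    using inj_on by (intro bijective_open_imp_homeomorphic_map) simp_all
  with u show ?thesis by (simp add: iso_into_def embedding_map_def)
qed

end

section \<open>The dual space\<close>

lemma ex_real_part:
  "\<exists>f::'k::real_or_complex \<Rightarrow> real. (\<forall>x y. f (x + y) = f x + f y) \<and> (\<forall>x t. f (of_real t * x) = t * f x) \<and>
     (\<forall>x. f x \<le> norm x) \<and> f 1 = 1"
proof -
  interpret real_subspace "\<lambda>t x. of_real t * x" "UNIV :: 'k set"
  proof (rule real_subspace.intro)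
    show "vector_space (\<lambda>t x. of_real t * (x :: 'k))"
      by standard (auto simp: algebra_simps)
    then interpret vector_space "\<lambda>t x. of_real t * (x :: 'k)" .
    show "real_subspace_axioms (\<lambda>t x. of_real t * x) (UNIV :: 'k set)"
      by standard simp
  qed
  have "sublinear_on (\<lambda>t x. of_real t * x) UNIV (norm :: 'k \<Rightarrow> real)"
    by (auto simp: sublinear_on_def norm_triangle_ineq norm_mult)
  from hahn_banach_sublinear[OF this UNIV_I, of 1] show ?thesis by simp
qed

text \<open>The Hahn--Banach theorem yields a real part without distinguishing \<open>\<real>\<close> and \<open>\<complex>\<close>.\<close>

definition real_part :: "'k::real_or_complex \<Rightarrow> real" where
  "real_part = (SOME f. (\<forall>x y. f (x + y) = f x + f y) \<and> (\<forall>x t. f (of_real t * x) = t * f x) \<and>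
     (\<forall>x. f x \<le> norm x) \<and> f 1 = 1)"

lemma real_part_add: "real_part (x + y) = real_part x + real_part y"
  and real_part_scale: "real_part (of_real t * x) = t * real_part x"
  and real_part_le_norm: "real_part x \<le> norm x"
  and real_part_one: "real_part (1 :: 'k) = 1"
  for x y :: "'k::real_or_complex"
  using someI_ex[OF ex_real_part[where 'k = 'k]] unfolding real_part_def[symmetric] by blast+

lemma real_part_minus: "real_part (- x) = - real_part x"
  using real_part_scale[of "- 1" x] by simp

lemma real_part_diff: "real_part (x - y) = real_part x - real_part y"
  using real_part_add[of "x - y" y] by simp

lemma abs_real_part_le_norm: "\<bar>real_part x\<bar> \<le> norm x"
  using real_part_le_norm[of x] real_part_le_norm[of "- x"] by (simp add: real_part_minus)

lemma real_part_sum: "real_part (\<Sum>i\<in>I. f i) = (\<Sum>i\<in>I. real_part (f i))"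
  using real_part_scale[of 0 0]
  by (induction I rule: infinite_finite_induct) (simp_all add: real_part_add)

text \<open>This recovers moduli from real parts: bounds on real parts over a set invariant under
  rotation are bounds on norms.\<close>

lemma ex_unimodular_real_part:
  fixes x :: "'k::real_or_complex"
  obtains c where "norm c = 1" "real_part (c * x) = norm x"
proof (cases "x = 0")
  case True
  then show thesis using that[of 1] real_part_scale[of 0 "0 :: 'k"] by simp
next
  case False
  have "real_part (of_real (norm x) * (1 :: 'k)) = norm x"
    unfolding real_part_scale real_part_one by simp
  with False show thesis using that[of "of_real (norm x) / x"] by (simp add: norm_divide)
qed

section \<open>Dual functionals and equicontinuous sets\<close>

context seminormed_space
begin

sublocale functional: seminormed_space_pair V "scalars :: ('k, 'k) lcs"
  by standard

lemma dual_iff: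
  "y \<in> dual V \<longleftrightarrow> linear_on V scalars y \<and> dominated (\<lambda>v. norm (y v)) \<and> (\<forall>v. v \<notin> vcar V \<longrightarrow> y v = 0)"
  by (simp add: dual_def functional.cont_linear_maps_iff_dominated)

lemma dualD:
  assumes "y \<in> dual V"
  shows "v \<in> vcar V \<Longrightarrow> w \<in> vcar V \<Longrightarrow> y (v + w) = y v + y w"
    "v \<in> vcar V \<Longrightarrow> w \<in> vcar V \<Longrightarrow> y (v - w) = y v - y w"
    "v \<in> vcar V \<Longrightarrow> y (scl V c v) = c * y v"
    "dominated (\<lambda>v. norm (y v))"
    "v \<notin> vcar V \<Longrightarrow> y v = 0"
  using assms functional.linear_onD[of y] functional.linear_on_diff[of y] by (auto simp: dual_iff)

lemma vector_space_functionals: "vector_space (pw_scl (scalars :: ('k, 'k) lcs) :: 'k \<Rightarrow> ('v \<Rightarrow> 'k) \<Rightarrow> _)"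
  by (rule vector_space_pw_scl[OF scalars.vector_space])

lemma dual_closed:
  shows "0 \<in> dual V" "y \<in> dual V \<Longrightarrow> z \<in> dual V \<Longrightarrow> y + z \<in> dual V"
    "y \<in> dual V \<Longrightarrow> (\<lambda>v. c * y v) \<in> dual V"
proof -
  interpret pw: vector_space "pw_scl (scalars :: ('k, 'k) lcs) :: 'k \<Rightarrow> ('v \<Rightarrow> 'k) \<Rightarrow> _"
    by (rule vector_space_functionals)
  note sub = functional.subspace_cont_linear_maps[folded dual_def]
  show "0 \<in> dual V" "y \<in> dual V \<Longrightarrow> z \<in> dual V \<Longrightarrow> y + z \<in> dual V"
    using pw.subspace_0[OF sub] pw.subspace_add[OF sub] by auto
  show "y \<in> dual V \<Longrightarrow> (\<lambda>v. c * y v) \<in> dual V"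
    using pw.subspace_scale[OF sub, of y c] by (simp add: pw_scl_def)
qed

text \<open>A single neighbourhood of 0 on which all of \<open>B\<close> is bounded by 1 yields a
  common dominating function; conversely, linearity carries domination from 0 to every other
  point.\<close>

lemma equicontinuous_iff_dominated:
  "equicontinuous V B \<longleftrightarrow> B \<subseteq> dual V \<and>
     (\<exists>g. dominated g \<and> (\<forall>y\<in>B. \<forall>v\<in>vcar V. norm (y v) \<le> g v))"
proof
  assume B: "equicontinuous V B"
  then have BD: "B \<subseteq> dual V" by (simp add: equicontinuous_def)
  have zero: "y 0 = 0" if "y \<in> B" for y using dualD(2)[of y 0 0] BD that by auto
  obtain U where U: "openin (lcs_top V) U" "0 \<in> U" "\<And>y w. y \<in> B \<Longrightarrow> w \<in> U \<Longrightarrow> norm (y w - y 0) < 1"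
    using B carrier(1) unfolding equicontinuous_def by (meson zero_less_one)
  obtain h where h: "dominated h"
    "\<And>g v. (\<And>w. w \<in> U \<Longrightarrow> g w \<le> 1) \<Longrightarrow>
      (\<And>w c. w \<in> vcar V \<Longrightarrow> 0 < c \<Longrightarrow> g (scl V (of_real c) w) = c * g w) \<Longrightarrow>
      v \<in> vcar V \<Longrightarrow> g v \<le> h v"
    by (rule dominated_if_bounded_near_zero[OF U(1,2)]) blast
  have "norm (y v) \<le> h v" if y: "y \<in> B" and v: "v \<in> vcar V" for y v
  proof (rule h(2)[of "\<lambda>v. norm (y v)"])
    show "w \<in> U \<Longrightarrow> norm (y w) \<le> 1" for w using U(3)[OF y, of w] zero[OF y] by simp
    show "w \<in> vcar V \<Longrightarrow> 0 < c \<Longrightarrow> norm (y (scl V (of_real c) w)) = c * norm (y w)" for w c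
      using dualD(3)[of y w "of_real c"] y BD by (auto simp: norm_mult)
  qed (rule v)
  with h(1) BD show "B \<subseteq> dual V \<and> (\<exists>g. dominated g \<and> (\<forall>y\<in>B. \<forall>v\<in>vcar V. norm (y v) \<le> g v))"
    by blast
next
  assume "B \<subseteq> dual V \<and> (\<exists>g. dominated g \<and> (\<forall>y\<in>B. \<forall>v\<in>vcar V. norm (y v) \<le> g v))"
  then obtain g where BD: "B \<subseteq> dual V" and g: "dominated g"
    "\<And>y v. y \<in> B \<Longrightarrow> v \<in> vcar V \<Longrightarrow> norm (y v) \<le> g v" by blast
  show "equicontinuous V B"
    unfolding equicontinuous_def
  proof (intro conjI BD ballI allI impI)
    fix v and \<epsilon> :: real assume v: "v \<in> vcar V" and \<epsilon>: "0 < \<epsilon>"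
    obtain U where U: "openin (lcs_top V) U" "v \<in> U" "\<And>w. w \<in> U \<Longrightarrow> g (w - v) < \<epsilon>"
      using dominated_neighbourhood[OF g(1) v \<epsilon>] by blast
    have "norm (y w - y v) < \<epsilon>" if "y \<in> B" "w \<in> U" for y w
    proof -
      have w: "w \<in> vcar V" using U(1) that(2) openin_subset by fastforce
      then show ?thesis
        using g(2)[OF that(1), of "w - v"] U(3)[OF that(2)] dualD(2)[of y w v] BD that(1) v by auto
    qed
    with U(1,2) show "\<exists>U. openin (lcs_top V) U \<and> v \<in> U \<and> (\<forall>y\<in>B. \<forall>w\<in>U. norm (y w - y v) < \<epsilon>)"
      by blast
  qed
qed

lemma equicontinuous_singleton: "y \<in> dual V \<Longrightarrow> equicontinuous V {y}"
  using dualD(4) by (auto simp: equicontinuous_iff_dominated)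

lemma equicontinuous_bounded_on_compact:
  assumes "equicontinuous V B" and K: "compactin (lcs_top V) K"
  shows "\<exists>b. \<forall>y\<in>B. \<forall>v\<in>K. norm (y v) \<le> b"
proof -
  obtain g where g: "dominated g" "\<And>y v. y \<in> B \<Longrightarrow> v \<in> vcar V \<Longrightarrow> norm (y v) \<le> g v"
    using assms(1) by (auto simp: equicontinuous_iff_dominated)
  moreover have "K \<subseteq> vcar V" using compactin_subset_topspace[OF K] by simp
  ultimately show ?thesis using dominated_bounded_on_compact[OF g(1) K] by (meson order_trans subsetD)
qed

section \<open>Compact discs and the topology \<kappa> on the dual\<close>

definition compact_disc :: "'v set \<Rightarrow> bool" where
  "compact_disc K \<longleftrightarrow> K \<noteq> {} \<and> absolutely_convex V K \<and> compactin (lcs_top V) K"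

lemma compact_discD:
  assumes "compact_disc K"
  shows "K \<noteq> {}" "compactin (lcs_top V) K" "K \<subseteq> vcar V" "0 \<in> K"
    "v \<in> K \<Longrightarrow> w \<in> K \<Longrightarrow> norm a + norm b \<le> 1 \<Longrightarrow> scl V a v + scl V b w \<in> K"
    "v \<in> K \<Longrightarrow> norm a \<le> 1 \<Longrightarrow> scl V a v \<in> K"
proof -
  show K: "K \<noteq> {}" "compactin (lcs_top V) K" "K \<subseteq> vcar V"
    and conv: "v \<in> K \<Longrightarrow> w \<in> K \<Longrightarrow> norm a + norm b \<le> 1 \<Longrightarrow> scl V a v + scl V b w \<in> K" for v w a b
    using assms by (auto simp: compact_disc_def absolutely_convex_def)
  show "0 \<in> K" using K(1) conv[of _ _ 0 0] by auto
  then show "v \<in> K \<Longrightarrow> norm a \<le> 1 \<Longrightarrow> scl V a v \<in> K" using conv[of v 0 a 0] by simp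
qed

lemma compact_disc_zero: "compact_disc {0}"
  by (auto simp: compact_disc_def absolutely_convex_def)

text \<open>Each disc contains 0, so the sum contains both summands. Thus finitely many seminorms of
  \<open>dual_kappa V\<close> lie below a single one.\<close>

lemma compact_disc_plus:
  assumes K: "compact_disc K" and L: "compact_disc L"
  shows "compact_disc {v + w | v w. v \<in> K \<and> w \<in> L}"
proof -
  note KD = compact_discD[OF K] and LD = compact_discD[OF L]
  have "scl V a (v + w) + scl V b (v' + w') \<in> {v + w | v w. v \<in> K \<and> w \<in> L}"
    if "v \<in> K" "w \<in> L" "v' \<in> K" "w' \<in> L" "norm a + norm b \<le> 1" for v w v' w' a b
  proof -
    have "scl V a (v + w) + scl V b (v' + w') = (scl V a v + scl V b v') + (scl V a w + scl V b w')"
      by (simp add: scale_right_distrib algebra_simps)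
    with KD(5)[OF that(1,3,5)] LD(5)[OF that(2,4,5)] show ?thesis by blast
  qed
  moreover have "{v + w | v w. v \<in> K \<and> w \<in> L} \<subseteq> vcar V" using KD(3) LD(3) by (auto simp: subset_iff)
  moreover have "{v + w | v w. v \<in> K \<and> w \<in> L} \<noteq> {}" using KD(1) LD(1) by blast
  ultimately show ?thesis
    using compactin_plus[OF KD(2) LD(2)] unfolding compact_disc_def absolutely_convex_def by blast
qed

definition disc_norm :: "'v set \<Rightarrow> ('v \<Rightarrow> 'k) \<Rightarrow> real" where
  "disc_norm K y = (SUP v\<in>K. norm (y v))"

lemma norm_le_disc_norm:
  assumes K: "compact_disc K" and y: "y \<in> dual V" and v: "v \<in> K"
  shows "norm (y v) \<le> disc_norm K y"
proof -
  obtain b where "\<And>v. v \<in> K \<Longrightarrow> norm (y v) \<le> b"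
    using dominated_bounded_on_compact[OF dualD(4)[OF y] compact_discD(2)[OF K]] by blast
  then show ?thesis unfolding disc_norm_def using v by (intro cSUP_upper bdd_aboveI2) auto
qed

lemma disc_norm_le:
  "compact_disc K \<Longrightarrow> (\<And>v. v \<in> K \<Longrightarrow> norm (y v) \<le> b) \<Longrightarrow> disc_norm K y \<le> b"
  unfolding disc_norm_def by (intro cSUP_least compact_discD)

lemma disc_norm_plus_ge:
  assumes K: "compact_disc K" and L: "compact_disc L" and y: "y \<in> dual V"
  shows "disc_norm K y \<le> disc_norm {v + w | v w. v \<in> K \<and> w \<in> L} y"
    "disc_norm L y \<le> disc_norm {v + w | v w. v \<in> K \<and> w \<in> L} y"
proof -
  have "K \<subseteq> {v + w | v w. v \<in> K \<and> w \<in> L}" "L \<subseteq> {v + w | v w. v \<in> K \<and> w \<in> L}"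
    using compact_discD(4)[OF K] compact_discD(4)[OF L] by force+
  then show "disc_norm K y \<le> disc_norm {v + w | v w. v \<in> K \<and> w \<in> L} y"
    "disc_norm L y \<le> disc_norm {v + w | v w. v \<in> K \<and> w \<in> L} y"
    using K L by (auto intro!: disc_norm_le norm_le_disc_norm compact_disc_plus y)
qed

lemma dual_kappa_simps:
  "vcar (dual_kappa V) = dual V"
  "scl (dual_kappa V) = pw_scl scalars"
  "snorms (dual_kappa V) = disc_norm ` {K. compact_disc K}"
  by (auto simp: dual_kappa_def pw_scl_def compact_disc_def disc_norm_def fun_eq_iff)

lemma seminormed_space_dual_kappa: "seminormed_space (dual_kappa V)"
proof (rule seminormed_space.intro)
  show "vector_space (scl (dual_kappa V))"
    unfolding dual_kappa_simps by (rule vector_space_functionals)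
  show "module.subspace (scl (dual_kappa V)) (vcar (dual_kappa V))"
    unfolding dual_kappa_simps using functional.subspace_cont_linear_maps by (simp add: dual_def)
  fix q assume "q \<in> snorms (dual_kappa V)"
  then obtain K where K: "compact_disc K" and q: "q = disc_norm K" by (auto simp: dual_kappa_simps)
  show "seminorm_on (dual_kappa V) q"
    unfolding seminorm_on_def dual_kappa_simps q
  proof (intro conjI ballI allI)
    fix y assume y: "y \<in> dual V"
    show "0 \<le> disc_norm K y"
      using norm_le_disc_norm[OF K y compact_discD(4)[OF K]] by (meson norm_ge_zero order_trans)
    fix z assume z: "z \<in> dual V"
    show "disc_norm K (y + z) \<le> disc_norm K y + disc_norm K z"
      using norm_le_disc_norm[OF K y] norm_le_disc_norm[OF K z]
      by (intro disc_norm_le[OF K]) (auto intro: norm_triangle_le add_mono)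
  next
    fix y c assume y: "y \<in> dual V"
    \<comment> \<open>The reverse inequality comes from this one by scaling back with
      \<open>inverse c\<close>, with c = 0 treated apart.\<close>
    have le: "disc_norm K (\<lambda>v. a * z v) \<le> norm a * disc_norm K z" if "z \<in> dual V" for a z
      using norm_le_disc_norm[OF K that]
      by (intro disc_norm_le[OF K]) (simp add: norm_mult mult_left_mono)
    have "norm c * disc_norm K y \<le> disc_norm K (\<lambda>v. c * y v)"
    proof (cases "c = 0")
      case True
      then show ?thesis using compact_discD(1)[OF K] by (simp add: disc_norm_def)
    next
      case False
      then have "disc_norm K y \<le> norm (inverse c) * disc_norm K (\<lambda>v. c * y v)"
        using le[OF dual_closed(3)[OF y, of c], of "inverse c"]
        by (simp add: mult.assoc[symmetric])
      then have "disc_norm K y \<le> disc_norm K (\<lambda>v. c * y v) / norm c"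
        by (simp only: norm_inverse divide_inverse mult.commute)
      with False show ?thesis by (simp add: field_simps)
    qed
    with le[OF y, of c] show "disc_norm K (pw_scl scalars c y) = norm c * disc_norm K y"
      by (simp add: pw_scl_def)
  qed
qed

interpretation kappa: seminormed_space "dual_kappa V"
  by (rule seminormed_space_dual_kappa)

lemma kappa_dominatedE:
  assumes "kappa.dominated g"
  obtains K C where "compact_disc K" "0 < C" "\<And>y. y \<in> dual V \<Longrightarrow> g y \<le> C * disc_norm K y"
proof -
  obtain Q C where Q: "finite Q" "Q \<subseteq> snorms (dual_kappa V)" "0 \<le> C"
    "\<And>y. y \<in> dual V \<Longrightarrow> g y \<le> C * (\<Sum>q\<in>Q. q y)"
    using assms kappa.dominatedE unfolding dual_kappa_simps(1) by blast
  have "\<exists>K. compact_disc K \<and> (\<forall>q\<in>Q. \<forall>y\<in>dual V. q y \<le> disc_norm K y)"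
    using Q(1,2)
  proof (induction Q rule: finite_induct)
    case empty
    then show ?case using compact_disc_zero by blast
  next
    case (insert q Q)
    then obtain K where K: "compact_disc K" "\<And>q y. q \<in> Q \<Longrightarrow> y \<in> dual V \<Longrightarrow> q y \<le> disc_norm K y"
      by auto
    obtain L where L: "compact_disc L" "q = disc_norm L"
      using insert.prems by (auto simp: dual_kappa_simps)
    show ?case
      using K L compact_disc_plus[OF K(1) L(1)] disc_norm_plus_ge[OF K(1) L(1)]
      by (intro exI[of _ "{v + w | v w. v \<in> K \<and> w \<in> L}"]) (blast intro: order_trans)
  qed
  then obtain K where K: "compact_disc K" "\<And>q y. q \<in> Q \<Longrightarrow> y \<in> dual V \<Longrightarrow> q y \<le> disc_norm K y"
    by blast
  \<comment> \<open>The summand 1 makes the constant strictly positive, so that it can be divided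
    out and used in the Mackey-Arens argument.\<close>
  have "g y \<le> (C * card Q + 1) * disc_norm K y" if y: "y \<in> dual V" for y
  proof -
    have "0 \<le> disc_norm K y"
      using norm_le_disc_norm[OF K(1) y compact_discD(4)[OF K(1)]] by (meson norm_ge_zero order_trans)
    moreover have "C * (\<Sum>q\<in>Q. q y) \<le> C * (card Q * disc_norm K y)"
      using K(2) y Q(3) by (intro mult_left_mono sum_bounded_above) auto
    ultimately show ?thesis using Q(4)[OF y] by (simp add: algebra_simps)
  qed
  moreover have "0 < C * card Q + 1" using Q(3) by (simp add: add_nonneg_pos)
  ultimately show thesis using that K(1) by blast
qed

end

section \<open>Real-linear functionals on the dual as evaluations at points\<close>

lemma real_subspace_of_real:
  fixes s :: "'k::real_or_complex \<Rightarrow> 'v::ab_group_add \<Rightarrow> 'v"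
  assumes "vector_space s" "module.subspace s X"
  shows "real_subspace (\<lambda>t. s (of_real t)) X"
proof (rule real_subspace.intro)
  interpret k: vector_space s by (rule assms)
  show "vector_space (\<lambda>t. s (of_real t))"
    by standard (simp_all add: k.scale_right_distrib k.scale_left_distrib)
  then interpret r: vector_space "\<lambda>t. s (of_real t)" .
  show "real_subspace_axioms (\<lambda>t. s (of_real t)) X"
    by standard (use assms(2) in \<open>simp add: r.subspace_def k.subspace_def\<close>)
qed

context seminormed_space
begin

lemma dual_sum:
  "(\<And>y. y \<in> F \<Longrightarrow> y \<in> dual V) \<Longrightarrow> (\<lambda>v. \<Sum>y\<in>F. of_real (z y) * y v) \<in> dual V"
proof (induction F rule: infinite_finite_induct)
  case (insert y F)
  have "(\<lambda>v. of_real (z y) * y v) + (\<lambda>v. \<Sum>y\<in>F. of_real (z y) * y v) \<in> dual V"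
    using insert by (intro dual_closed) auto
  then show ?case using insert.hyps by (simp add: plus_fun_def)
qed (use dual_closed(1) in \<open>simp_all add: zero_fun_def\<close>)

text \<open>The finite-dimensional part of the Mackey--Arens theorem: at a minimiser over \<open>K\<close> of the
  squared distance to the prescribed values, the first order condition says that the residual
  functional attains its supremum over \<open>K\<close>, which forces the residual to vanish.\<close>

lemma finitely_many_values_attained:
  assumes K: "compact_disc K" and C: "0 < C"
    and add: "\<And>y z. y \<in> dual V \<Longrightarrow> z \<in> dual V \<Longrightarrow> \<phi> (y + z) = \<phi> y + \<phi> z"
    and scale: "\<And>y t. y \<in> dual V \<Longrightarrow> \<phi> (\<lambda>v. of_real t * y v) = t * \<phi> y"
    and bound: "\<And>y. y \<in> dual V \<Longrightarrow> \<phi> y \<le> C * disc_norm K y"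
    and cont: "\<And>y. y \<in> dual V \<Longrightarrow>
      continuous_map (lcs_top V) euclideanreal (\<lambda>v. \<phi> y - C * real_part (y v))"
    and F: "finite F" "F \<subseteq> dual V"
  shows "\<exists>v\<in>K. \<forall>y\<in>F. \<phi> y = C * real_part (y v)"
proof -
  note KD = compact_discD[OF K]
  define h where "h v = (\<Sum>y\<in>F. (\<phi> y - C * real_part (y v))\<^sup>2)" for v
  have "continuous_map (lcs_top V) euclideanreal h"
    unfolding h_def using F by (intro continuous_map_sum continuous_map_real_pow cont) auto
  then have "compact (h ` K)" using image_compactin[OF KD(2)] by fastforce
  then obtain v\<^sub>0 where v\<^sub>0: "v\<^sub>0 \<in> K" "\<And>v. v \<in> K \<Longrightarrow> h v\<^sub>0 \<le> h v"
    using compact_attains_inf[of "h ` K"] KD(1) by auto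
  define z where "z y = \<phi> y - C * real_part (y v\<^sub>0)" for y
  \<comment> \<open>The derivative of \<open>h\<close> at the minimiser in direction w is
    \<open>-2 * C\<close> times the real part of Y(w); along segments inside \<open>K\<close> it
    cannot be negative.\<close>
  define Y where "Y = (\<lambda>v. \<Sum>y\<in>F. of_real (z y) * y v)"
  have Y: "Y \<in> dual V" unfolding Y_def using F by (intro dual_sum) auto
  have rY: "real_part (Y v) = (\<Sum>y\<in>F. z y * real_part (y v))" for v
    by (simp add: Y_def real_part_sum real_part_scale)
  have \<phi>Y: "\<phi> Y = (\<Sum>y\<in>F. z y * \<phi> y)"
    using F unfolding Y_def
  proof (induction F rule: finite_induct)
    case empty
    show ?case using scale[OF dual_closed(1), of 0] by simp
  next
    case (insert y F)
    then have "\<phi> ((\<lambda>v. of_real (z y) * y v) + (\<lambda>v. \<Sum>y\<in>F. of_real (z y) * y v)) =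
        z y * \<phi> y + (\<Sum>y\<in>F. z y * \<phi> y)"
      by (subst add) (auto intro!: dual_closed dual_sum simp: scale)
    with insert.hyps show ?case by (simp add: plus_fun_def)
  qed
  have Y_le: "real_part (Y v) \<le> real_part (Y v\<^sub>0)" if v: "v \<in> K" for v
  proof (rule ccontr)
    define w where "w y = C * (real_part (y v) - real_part (y v\<^sub>0))" for y :: "'v \<Rightarrow> 'k"
    define A where "A = (\<Sum>y\<in>F. z y * w y)"
    define D where "D = (\<Sum>y\<in>F. (w y)\<^sup>2)"
    assume "\<not> ?thesis"
    then have "0 < C * (real_part (Y v) - real_part (Y v\<^sub>0))" using C by simp
    also have "\<dots> = A"
      by (simp add: A_def w_def rY sum_distrib_left right_diff_distrib sum_subtractf algebra_simps)
    finally have A: "A > 0" .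
    have D: "D \<ge> 0" by (simp add: D_def sum_nonneg)
    \<comment> \<open>Moving the fraction \<open>t\<close> of the way from the minimiser to
      \<open>v\<close> stays in \<open>K\<close> and changes \<open>h\<close> by
      \<open>- 2 * t * A + t\<^sup>2 * D\<close>, which must be nonnegative.\<close>
    have key: "2 * A \<le> t * D" if t: "0 < t" "t \<le> 1" for t
    proof -
      define v' where "v' = scl V (of_real (1 - t)) v\<^sub>0 + scl V (of_real t) v"
      have "norm (of_real (1 - t) :: 'k) + norm (of_real t :: 'k) \<le> 1"
        using t by (simp del: of_real_diff)
      then have v': "v' \<in> K" unfolding v'_def by (rule KD(5)[OF v\<^sub>0(1) v])
      have residual: "\<phi> y - C * real_part (y v') = z y - t * w y" if y: "y \<in> F" for y
      proof -
        have "y v' = of_real (1 - t) * y v\<^sub>0 + of_real t * y v"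
          using y F(2) KD(3) v v\<^sub>0(1) unfolding v'_def
          by (subst dualD(1)[of y]) (auto simp: dualD(3)[of y] subset_iff simp del: of_real_diff)
        then have eq: "real_part (y v') = (1 - t) * real_part (y v\<^sub>0) + t * real_part (y v)"
          by (simp only: real_part_add real_part_scale)
        show ?thesis unfolding z_def w_def eq by (simp add: algebra_simps)
      qed
      have "h v' = (\<Sum>y\<in>F. (z y)\<^sup>2 - 2 * t * (z y * w y) + t\<^sup>2 * (w y)\<^sup>2)"
        unfolding h_def by (intro sum.cong refl) (simp add: residual power2_eq_square algebra_simps)
      also have "\<dots> = h v\<^sub>0 - 2 * t * A + t\<^sup>2 * D"
        by (simp add: h_def z_def A_def D_def sum.distrib sum_subtractf sum_distrib_left)
      finally have "t * (2 * A) \<le> t * (t * D)"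
        using v\<^sub>0(2)[OF v'] by (simp add: power2_eq_square algebra_simps)
      with t show ?thesis by simp
    qed
    \<comment> \<open>Chosen so that \<open>t * D \<le> A\<close>, against
      \<open>2 * A \<le> t * D\<close>; the denominator \<open>D + 1\<close> also covers D =
      0.\<close>
    define t where "t = min 1 (A / (D + 1))"
    have "t * D \<le> (A / (D + 1)) * D" using D by (intro mult_right_mono) (simp_all add: t_def)
    also have "\<dots> \<le> A" using A D by (simp add: field_simps)
    finally have "t * D \<le> A" .
    moreover have "2 * A \<le> t * D" using A D by (intro key) (simp_all add: t_def)
    ultimately show False using A by simp
  qed
  have "disc_norm K Y \<le> real_part (Y v\<^sub>0)"
  proof (rule disc_norm_le[OF K])
    fix v assume v: "v \<in> K"
    \<comment> \<open>\<open>K\<close> is stable under multiplication by \<open>c\<close>, so the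
      bound on real parts over \<open>K\<close> becomes a bound on the norm.\<close>
    obtain c where c: "norm c = 1" "real_part (c * Y v) = norm (Y v)"
      using ex_unimodular_real_part .
    have "c * Y v = Y (scl V c v)" using dualD(3)[OF Y, of v c] v KD(3) by auto
    with Y_le[OF KD(6)[OF v, of c]] c show "norm (Y v) \<le> real_part (Y v\<^sub>0)" by simp
  qed
  then have "C * disc_norm K Y \<le> C * real_part (Y v\<^sub>0)" using C by simp
  with bound[OF Y] have "\<phi> Y \<le> C * real_part (Y v\<^sub>0)" by simp
  \<comment> \<open>The residual paired with itself: the left side has just been bounded by 0, so
    every residual vanishes.\<close>
  moreover have "\<phi> Y - C * real_part (Y v\<^sub>0) = (\<Sum>y\<in>F. (z y)\<^sup>2)"
    by (simp add: \<phi>Y rY sum_distrib_left sum_subtractf[symmetric] z_def power2_eq_square algebra_simps)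
  ultimately have "(\<Sum>y\<in>F. (z y)\<^sup>2) \<le> 0" by simp
  then have "(\<Sum>y\<in>F. (z y)\<^sup>2) = 0" using sum_nonneg[of F "\<lambda>y. (z y)\<^sup>2"] by simp
  then have "\<forall>y\<in>F. z y = 0" using F(1) by (simp add: sum_nonneg_eq_0_iff)
  then show ?thesis using v\<^sub>0(1) by (auto simp: z_def)
qed

text \<open>Stated for real parts of functionals on \<open>dual_kappa V\<close>; the finitely many values are upgraded to
  all of them by compactness of \<open>K\<close>.\<close>

lemma mackey_arens:
  assumes K: "compact_disc K" and C: "0 < C"
    and add: "\<And>y z. y \<in> dual V \<Longrightarrow> z \<in> dual V \<Longrightarrow> \<phi> (y + z) = \<phi> y + \<phi> z"
    and scale: "\<And>y t. y \<in> dual V \<Longrightarrow> \<phi> (\<lambda>v. of_real t * y v) = t * \<phi> y"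
    and bound: "\<And>y. y \<in> dual V \<Longrightarrow> \<phi> y \<le> C * disc_norm K y"
  shows "\<exists>v\<in>vcar V. \<forall>y\<in>dual V. \<phi> y = real_part (y v)"
proof -
  note KD = compact_discD[OF K]
  have cont: "continuous_map (lcs_top V) euclideanreal (\<lambda>v. \<phi> y - C * real_part (y v))"
    if y: "y \<in> dual V" for y
  proof (rule continuous_map_euclidean_if_dominated[OF dominated_scale[OF dualD(4)[OF y]]])
    fix v w assume "v \<in> vcar V" "w \<in> vcar V"
    then have eq: "y (w - v) = y w - y v" by (rule dualD(2)[OF y, rotated])
    have "dist (\<phi> y - C * real_part (y v)) (\<phi> y - C * real_part (y w)) =
        \<bar>C * real_part (y (w - v))\<bar>"
      unfolding eq real_part_diff dist_real_def by (simp add: algebra_simps)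
    also have "\<dots> \<le> C * norm (y (w - v))"
      using C abs_real_part_le_norm[of "y (w - v)"] by (simp add: abs_mult)
    finally show "dist (\<phi> y - C * real_part (y v)) (\<phi> y - C * real_part (y w)) \<le> C * norm (y (w - v))" .
  qed (use C in simp)
  define Z where "Z y = {v \<in> topspace (lcs_top V). \<phi> y - C * real_part (y v) \<in> {0}}" for y
  have "closedin (lcs_top V) (Z y)" if "y \<in> dual V" for y
    unfolding Z_def by (rule closedin_continuous_map_preimage[OF cont[OF that]]) simp
  moreover have "K \<inter> \<Inter> \<F> \<noteq> {}" if fin: "finite \<F>" "\<F> \<subseteq> Z ` dual V" for \<F>
  proof -
    obtain F where F: "finite F" "F \<subseteq> dual V" "\<F> = Z ` F"
      using finite_subset_image[OF fin] by blast
    obtain v where "v \<in> K" "\<forall>y\<in>F. \<phi> y = C * real_part (y v)"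
      using finitely_many_values_attained[OF K C add scale bound cont F(1,2)] by blast
    with KD(3) have "v \<in> K \<inter> \<Inter> \<F>" by (auto simp: F(3) Z_def)
    then show ?thesis by blast
  qed
  ultimately have "K \<inter> \<Inter> (Z ` dual V) \<noteq> {}"
    using KD(2) unfolding compactin_fip by blast
  then obtain v where v: "v \<in> K" "\<And>y. y \<in> dual V \<Longrightarrow> \<phi> y = C * real_part (y v)"
    by (auto simp: Z_def)
  \<comment> \<open>The constant \<open>C\<close> is absorbed into the point, which may thereby
    leave \<open>K\<close> but not the carrier.\<close>
  have "\<phi> y = real_part (y (scl V (of_real C) v))" if y: "y \<in> dual V" for y
    using v(1) KD(3) v(2)[OF y] dualD(3)[OF y, of v "of_real C"] by (auto simp: real_part_scale)
  then show ?thesis using v(1) KD(3) by (intro bexI[of _ "scl V (of_real C) v"]) auto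
qed

lemma ex_real_support_functional:
  assumes p: "p \<in> snorms V" and e: "e \<in> vcar V"
  shows "\<exists>f. (\<forall>x\<in>vcar V. \<forall>y\<in>vcar V. f (x + y) = f x + f y) \<and>
    (\<forall>x\<in>vcar V. \<forall>t. f (scl V (of_real t) x) = t * f x) \<and> (\<forall>x\<in>vcar V. f x \<le> p x) \<and> f e = p e"
proof -
  interpret real: real_subspace "\<lambda>t. scl V (of_real t)" "vcar V"
    by (rule real_subspace_of_real[OF vector_space subspace])
  \<comment> \<open>The seminorm is arbitrary off the carrier, whereas \<open>sublinear_on\<close>
    asks for the value 0 there.\<close>
  define p' where "p' x = (if x \<in> vcar V then p x else 0)" for x
  have "sublinear_on (\<lambda>t. scl V (of_real t)) (vcar V) p'"
    using p by (auto simp: sublinear_on_def p'_def snorm_add snorm_scale)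
  from real.hahn_banach_sublinear[OF this e] show ?thesis using e by (auto simp: p'_def)
qed

end

section \<open>The epsilon product\<close>

context seminormed_space_pair
begin

interpretation kappa: seminormed_space "dual_kappa V"
  by (rule V.seminormed_space_dual_kappa)

interpretation L: seminormed_space_pair "dual_kappa V" W
  by standard

lemma eps_product_simps:
  "vcar (eps_product V W) = cont_linear_maps (dual_kappa V) W"
  "scl (eps_product V W) = pw_scl W"
  "snorms (eps_product V W) =
    {(\<lambda>u. SUP y\<in>B. p (u y)) | B p. B \<noteq> {} \<and> equicontinuous V B \<and> p \<in> snorms W}"
  by (simp_all add: eps_product_def pw_scl_def fun_eq_iff)

lemma eps_productD:
  assumes "u \<in> vcar (eps_product V W)"
  shows "y \<in> dual V \<Longrightarrow> u y \<in> vcar W"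
    "y \<in> dual V \<Longrightarrow> z \<in> dual V \<Longrightarrow> u (y + z) = u y + u z"
    "y \<in> dual V \<Longrightarrow> u (\<lambda>v. c * y v) = scl W c (u y)"
    "p \<in> snorms W \<Longrightarrow> kappa.dominated (\<lambda>y. p (u y))"
    "y \<notin> dual V \<Longrightarrow> u y = 0"
  using assms L.linear_onD[of u]
  by (auto simp: eps_product_simps L.cont_linear_maps_iff_dominated V.dual_kappa_simps pw_scl_def)

text \<open>Continuity bounds p(u(y)) by a multiple of the supremum of |y| over a compact disc, and
  an equicontinuous set is uniformly bounded on compact sets. Hence the real suprema in
  \<open>eps_product\<close> are genuine.\<close>

lemma eps_product_bounded:
  assumes u: "u \<in> vcar (eps_product V W)" and B: "equicontinuous V B" and p: "p \<in> snorms W"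
  shows "bdd_above ((\<lambda>y. p (u y)) ` B)"
proof -
  obtain K C where K: "V.compact_disc K" "0 < C"
    "\<And>y. y \<in> dual V \<Longrightarrow> p (u y) \<le> C * V.disc_norm K y"
    using V.kappa_dominatedE[OF eps_productD(4)[OF u p]] by blast
  obtain b where b: "\<And>y v. y \<in> B \<Longrightarrow> v \<in> K \<Longrightarrow> norm (y v) \<le> b"
    using V.equicontinuous_bounded_on_compact[OF B V.compact_discD(2)[OF K(1)]] by blast
  have "p (u y) \<le> C * b" if "y \<in> B" for y
  proof -
    have "y \<in> dual V" using B that by (auto simp: equicontinuous_def)
    moreover have "C * V.disc_norm K y \<le> C * b"
      using K(2) b[OF that] by (intro mult_left_mono V.disc_norm_le[OF K(1)]) auto
    ultimately show ?thesis using K(3) order_trans by blast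
  qed
  then show ?thesis by (intro bdd_aboveI2)
qed

lemma seminormed_space_eps_product: "seminormed_space (eps_product V W)"
proof (rule seminormed_space.intro)
  interpret eps: vector_space "pw_scl W :: 'k \<Rightarrow> (('v \<Rightarrow> 'k) \<Rightarrow> 'w) \<Rightarrow> _"
    by (rule vector_space_pw_scl[OF W.vector_space])
  show "vector_space (scl (eps_product V W))"
    unfolding eps_product_simps by (rule vector_space_pw_scl[OF W.vector_space])
  show "module.subspace (scl (eps_product V W)) (vcar (eps_product V W))"
    unfolding eps_product_simps by (rule L.subspace_cont_linear_maps)
  fix q assume "q \<in> snorms (eps_product V W)"
  then obtain B p where B: "B \<noteq> {}" "equicontinuous V B" and p: "p \<in> snorms W"
    and q: "q = (\<lambda>u. SUP y\<in>B. p (u y))" by (auto simp: eps_product_simps)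
  have BD: "y \<in> dual V" if "y \<in> B" for y using B(2) that by (auto simp: equicontinuous_def)
  have upper: "p (u y) \<le> q u" if "u \<in> vcar (eps_product V W)" "y \<in> B" for u y
    unfolding q using that eps_product_bounded[OF _ B(2) p] by (intro cSUP_upper)
  have least: "q u \<le> b" if "\<And>y. y \<in> B \<Longrightarrow> p (u y) \<le> b" for u b
    unfolding q using that B(1) by (intro cSUP_least)
  show "seminorm_on (eps_product V W) q"
    unfolding seminorm_on_def
  proof (intro conjI ballI allI)
    fix u assume u: "u \<in> vcar (eps_product V W)"
    obtain y where y: "y \<in> B" using B(1) by blast
    show "0 \<le> q u"
      using upper[OF u y] W.snorm_nonneg[OF p eps_productD(1)[OF u BD[OF y]]] by simp
    fix u' assume u': "u' \<in> vcar (eps_product V W)"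
    show "q (u + u') \<le> q u + q u'"
    proof (rule least)
      fix y assume y: "y \<in> B"
      have "p ((u + u') y) \<le> p (u y) + p (u' y)"
        using W.snorm_add[OF p] eps_productD(1)[OF u] eps_productD(1)[OF u'] BD[OF y] by simp
      with upper[OF u y] upper[OF u' y] show "p ((u + u') y) \<le> q u + q u'" by simp
    qed
  next
    fix u c assume u: "u \<in> vcar (eps_product V W)"
    have eq: "p (pw_scl W c u y) = norm c * p (u y)" if "y \<in> B" for y
      using W.snorm_scale[OF p] eps_productD(1)[OF u BD[OF that]] by (simp add: pw_scl_def)
    have "norm c * q u \<le> q (pw_scl W c u)"
    proof (cases "c = 0")
      case True
      have "q (pw_scl W c u) = 0" using B(1) eq True unfolding q by simp
      with True show ?thesis by simp
    next
      case False
      have "pw_scl W c u \<in> vcar (eps_product V W)"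
        using eps.subspace_scale[OF L.subspace_cont_linear_maps] u by (simp add: eps_product_simps)
      from upper[OF this] have "q u \<le> q (pw_scl W c u) / norm c"
        using False by (intro least) (simp add: eq field_simps)
      with False show ?thesis by (simp add: field_simps)
    qed
    moreover have "q (pw_scl W c u) \<le> norm c * q u"
      using upper[OF u] by (intro least) (simp add: eq mult_left_mono)
    ultimately show "q (scl (eps_product V W) c u) = norm c * q u" by (simp add: eps_product_simps)
  qed
qed

text \<open>The first assumption says that \<open>y\<close> lies in \<open>C\<close> times the bipolar of \<open>A\<close>; since
  \<open>p (u y)\<close> is attained by a functional \<open>f \<circ> u\<close>, which is evaluation at a point by Mackey--Arens,
  no bipolar theorem is needed.\<close>

lemma bipolar_estimate:
  assumes bipolar: "\<And>v M. v \<in> vcar V \<Longrightarrow> (\<And>a. a \<in> A \<Longrightarrow> norm (a v) \<le> M) \<Longrightarrow> norm (y v) \<le> C * M"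
    and u: "u \<in> vcar (eps_product V W)" and p: "p \<in> snorms W"
    and A: "A \<subseteq> dual V" and y: "y \<in> dual V" and M: "\<And>a. a \<in> A \<Longrightarrow> p (u a) \<le> M"
  shows "p (u y) \<le> C * M"
proof -
  obtain f where f: "\<And>x x'. x \<in> vcar W \<Longrightarrow> x' \<in> vcar W \<Longrightarrow> f (x + x') = f x + f x'"
    "\<And>x t. x \<in> vcar W \<Longrightarrow> f (scl W (of_real t) x) = t * f x"
    "\<And>x. x \<in> vcar W \<Longrightarrow> f x \<le> p x" "f (u y) = p (u y)"
    using W.ex_real_support_functional[OF p eps_productD(1)[OF u y]] by blast
  obtain K D where K: "V.compact_disc K" "0 < D"
    "\<And>y. y \<in> dual V \<Longrightarrow> p (u y) \<le> D * V.disc_norm K y"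
    using V.kappa_dominatedE[OF eps_productD(4)[OF u p]] by blast
  have "f (u z) \<le> D * V.disc_norm K z" if "z \<in> dual V" for z
    using K(3)[OF that] f(3)[OF eps_productD(1)[OF u that]] by simp
  then have "\<exists>v\<in>vcar V. \<forall>z\<in>dual V. f (u z) = real_part (z v)"
    by (intro V.mackey_arens[OF K(1,2)]) (auto simp: eps_productD[OF u] f(1,2))
  then obtain v where v: "v \<in> vcar V" "\<And>z. z \<in> dual V \<Longrightarrow> f (u z) = real_part (z v)" by blast
  have "norm (a v) \<le> M" if a: "a \<in> A" for a
  proof -
    obtain c where c: "norm c = 1" "real_part (c * a v) = norm (a v)"
      using ex_unimodular_real_part .
    have aD: "a \<in> dual V" using a A by blast
    have "norm (a v) = f (u (\<lambda>v. c * a v))" using v(2)[OF V.dual_closed(3)[OF aD]] c(2) by simp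
    also have "\<dots> \<le> p (scl W c (u a))"
      using f(3) eps_productD(1)[OF u aD] by (simp add: eps_productD(3)[OF u aD])
    also have "\<dots> = p (u a)" using W.snorm_scale[OF p eps_productD(1)[OF u aD]] c(1) by simp
    finally show ?thesis using M[OF a] by simp
  qed
  then have "norm (y v) \<le> C * M" by (rule bipolar[OF v(1)])
  moreover have "p (u y) = real_part (y v)" using f(4) v(2)[OF y] by simp
  ultimately show ?thesis using real_part_le_norm[of "y v"] by simp
qed

end

section \<open>Weighted spaces\<close>

locale weighted_space = Y: seminormed_space Y
  for Y :: "('k::real_or_complex, 'y::ab_group_add) lcs" +
  fixes \<omega> :: "'m \<Rightarrow> 'x set"
    and \<nu> :: "'j \<Rightarrow> 'm \<Rightarrow> 'x \<Rightarrow> real"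
    and G :: "('w, 'm, 'x, 'y) oper_family"
  assumes weights: "weight_family \<omega> \<nu>"
    and operators: "linear_operators \<omega> Y G"
begin

lemma weight:
  "\<omega> m \<noteq> {}" "x \<in> \<omega> m \<Longrightarrow> 0 \<le> \<nu> j m x" "x \<in> \<omega> m \<Longrightarrow> \<exists>j. 0 < \<nu> j m x"
  using weights unfolding weight_family_def by blast+

lemma vector_space_pw: "vector_space (pw_scl Y :: 'k \<Rightarrow> ('w \<Rightarrow> 'y) \<Rightarrow> _)"
  by (rule vector_space_pw_scl[OF Y.vector_space])

lemma F_set_subset: "F_set G \<subseteq> all_funs Y"
  using operators by (auto simp: linear_operators_def F_set_def)

lemma subspace_F_set: "module.subspace (pw_scl Y) (F_set G)"
proof -
  interpret pw: vector_space "pw_scl Y :: 'k \<Rightarrow> ('w \<Rightarrow> 'y) \<Rightarrow> _" by (rule vector_space_pw)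
  show ?thesis
    using operators unfolding linear_operators_def F_set_def
    by (intro pw.subspace_inter pw.subspace_Inter) auto
qed

lemma oper:
  assumes "x \<in> \<omega> m" "f \<in> F_set G"
  shows "oper G m f x \<in> vcar Y"
    "g \<in> F_set G \<Longrightarrow> oper G m (f + g) x = oper G m f x + oper G m g x"
    "oper G m (pw_scl Y c f) x = scl Y c (oper G m f x)"
  using assms operators unfolding linear_operators_def F_set_def by blast+

lemma FV_simps:
  "scl (FV \<omega> \<nu> Y G) = pw_scl Y"
  "snorms (FV \<omega> \<nu> Y G) = {weighted_snorm \<omega> \<nu> G j m p | j m p. p \<in> snorms Y}"
  by (simp_all add: FV_def)

lemma FV_subset_F_set: "f \<in> vcar (FV \<omega> \<nu> Y G) \<Longrightarrow> f \<in> F_set G"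
  by (simp add: FV_def)

lemma weighted_snorm_upper:
  "f \<in> vcar (FV \<omega> \<nu> Y G) \<Longrightarrow> p \<in> snorms Y \<Longrightarrow> x \<in> \<omega> m \<Longrightarrow>
    p (oper G m f x) * \<nu> j m x \<le> weighted_snorm \<omega> \<nu> G j m p f"
  unfolding weighted_snorm_def by (intro cSUP_upper) (auto simp: FV_def)

lemma weighted_snorm_least:
  "(\<And>x. x \<in> \<omega> m \<Longrightarrow> p (oper G m f x) * \<nu> j m x \<le> b) \<Longrightarrow> weighted_snorm \<omega> \<nu> G j m p f \<le> b"
  unfolding weighted_snorm_def using weight(1) by (intro cSUP_least)

lemma FV_I:
  assumes "f \<in> F_set G"
    and "\<And>j m p. p \<in> snorms Y \<Longrightarrow> \<exists>b. \<forall>x\<in>\<omega> m. p (oper G m f x) * \<nu> j m x \<le> b"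
  shows "f \<in> vcar (FV \<omega> \<nu> Y G)"
  using assms by (auto simp: FV_def bdd_above_def)

text \<open>This pointwise form yields both that sums stay in the weighted space and the triangle
  inequality.\<close>

lemma weighted_add_le:
  assumes f: "f \<in> vcar (FV \<omega> \<nu> Y G)" and g: "g \<in> vcar (FV \<omega> \<nu> Y G)"
    and p: "p \<in> snorms Y" and x: "x \<in> \<omega> m"
  shows "p (oper G m (f + g) x) * \<nu> j m x \<le>
    weighted_snorm \<omega> \<nu> G j m p f + weighted_snorm \<omega> \<nu> G j m p g"
proof -
  note F = FV_subset_F_set[OF f] FV_subset_F_set[OF g]
  have "p (oper G m (f + g) x) * \<nu> j m x \<le> (p (oper G m f x) + p (oper G m g x)) * \<nu> j m x"
    using Y.snorm_add[OF p oper(1)[OF x F(1)] oper(1)[OF x F(2)]] weight(2)[OF x]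
    by (simp add: oper(2)[OF x F] mult_right_mono)
  with weighted_snorm_upper[OF f p x, of j] weighted_snorm_upper[OF g p x, of j]
  show ?thesis by (simp add: distrib_right)
qed

lemma weighted_scale:
  assumes f: "f \<in> vcar (FV \<omega> \<nu> Y G)" and p: "p \<in> snorms Y" and x: "x \<in> \<omega> m"
  shows "p (oper G m (pw_scl Y c f) x) = norm c * p (oper G m f x)"
  using Y.snorm_scale[OF p oper(1)[OF x]] FV_subset_F_set[OF f] oper(3)[OF x] by simp

lemma seminormed_space_FV: "seminormed_space (FV \<omega> \<nu> Y G)"
proof (rule seminormed_space.intro)
  interpret pw: vector_space "pw_scl Y :: 'k \<Rightarrow> ('w \<Rightarrow> 'y) \<Rightarrow> _" by (rule vector_space_pw)
  have scale_le: "p (oper G m (pw_scl Y c f) x) * \<nu> j m x \<le> norm c * weighted_snorm \<omega> \<nu> G j m p f"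
    if "f \<in> vcar (FV \<omega> \<nu> Y G)" "p \<in> snorms Y" "x \<in> \<omega> m" for f p j m x c
    using weighted_snorm_upper[OF that, of j] weighted_scale[OF that, of c]
    by (simp add: mult.assoc mult_left_mono)
  have scale_closed: "pw_scl Y c f \<in> vcar (FV \<omega> \<nu> Y G)" if "f \<in> vcar (FV \<omega> \<nu> Y G)" for f c
    using pw.subspace_scale[OF subspace_F_set FV_subset_F_set[OF that]] scale_le[OF that]
    by (intro FV_I) blast+
  show "vector_space (scl (FV \<omega> \<nu> Y G))" unfolding FV_simps by (rule vector_space_pw)
  show "module.subspace (scl (FV \<omega> \<nu> Y G)) (vcar (FV \<omega> \<nu> Y G))"
    unfolding FV_simps pw.subspace_def
  proof (intro conjI ballI allI)
    have zero: "0 \<in> F_set G" by (rule pw.subspace_0[OF subspace_F_set])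
    have "p (oper G m 0 x) * \<nu> j m x \<le> 0" if "p \<in> snorms Y" "x \<in> \<omega> m" for p j m x
      using oper(2)[OF that(2) zero zero] Y.snorm_zero[OF that(1)] by simp
    then show "0 \<in> vcar (FV \<omega> \<nu> Y G)" using zero by (intro FV_I) blast+
  next
    fix f g assume f: "f \<in> vcar (FV \<omega> \<nu> Y G)" and g: "g \<in> vcar (FV \<omega> \<nu> Y G)"
    show "f + g \<in> vcar (FV \<omega> \<nu> Y G)"
      using pw.subspace_add[OF subspace_F_set FV_subset_F_set[OF f] FV_subset_F_set[OF g]]
        weighted_add_le[OF f g] by (intro FV_I) blast+
  qed (rule scale_closed)
  fix q assume "q \<in> snorms (FV \<omega> \<nu> Y G)"
  then obtain j m p where q: "q = weighted_snorm \<omega> \<nu> G j m p" and p: "p \<in> snorms Y"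
    by (auto simp: FV_simps)
  show "seminorm_on (FV \<omega> \<nu> Y G) q"
    unfolding seminorm_on_def q
  proof (intro conjI ballI allI)
    fix f assume f: "f \<in> vcar (FV \<omega> \<nu> Y G)"
    obtain x where x: "x \<in> \<omega> m" using weight(1) by blast
    have "0 \<le> p (oper G m f x) * \<nu> j m x"
      using Y.snorm_nonneg[OF p oper(1)[OF x FV_subset_F_set[OF f]]] weight(2)[OF x] by simp
    with weighted_snorm_upper[OF f p x, of j] show "0 \<le> weighted_snorm \<omega> \<nu> G j m p f" by simp
    fix g assume g: "g \<in> vcar (FV \<omega> \<nu> Y G)"
    show "weighted_snorm \<omega> \<nu> G j m p (f + g) \<le>
        weighted_snorm \<omega> \<nu> G j m p f + weighted_snorm \<omega> \<nu> G j m p g"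
      by (intro weighted_snorm_least weighted_add_le f g p)
  next
    fix f c assume f: "f \<in> vcar (FV \<omega> \<nu> Y G)"
    have "norm c * weighted_snorm \<omega> \<nu> G j m p f \<le> weighted_snorm \<omega> \<nu> G j m p (pw_scl Y c f)"
    proof (cases "c = 0")
      case True
      have "p (oper G m (pw_scl Y c f) x) * \<nu> j m x = 0" if "x \<in> \<omega> m" for x
        using weighted_scale[OF f p that, of c] unfolding True by (simp only: norm_zero mult_zero_left)
      with weight(1)[of m] have "(\<lambda>x. p (oper G m (pw_scl Y c f) x) * \<nu> j m x) ` \<omega> m = {0}"
        by (auto simp del: mult_eq_0_iff simp: image_iff)
      then have "weighted_snorm \<omega> \<nu> G j m p (pw_scl Y c f) = 0" by (simp add: weighted_snorm_def)
      with True show ?thesis by simp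
    next
      case False
      have "weighted_snorm \<omega> \<nu> G j m p f \<le> weighted_snorm \<omega> \<nu> G j m p (pw_scl Y c f) / norm c"
      proof (rule weighted_snorm_least)
        fix x assume x: "x \<in> \<omega> m"
        show "p (oper G m f x) * \<nu> j m x \<le> weighted_snorm \<omega> \<nu> G j m p (pw_scl Y c f) / norm c"
          using weighted_snorm_upper[OF scale_closed[OF f, of c] p x, of j] weighted_scale[OF f p x, of c] False
          by (simp add: field_simps)
      qed
      with False show ?thesis by (simp add: field_simps)
    qed
    moreover have "weighted_snorm \<omega> \<nu> G j m p (pw_scl Y c f) \<le> norm c * weighted_snorm \<omega> \<nu> G j m p f"
      by (intro weighted_snorm_least scale_le f p)
    ultimately show "weighted_snorm \<omega> \<nu> G j m p (scl (FV \<omega> \<nu> Y G) c f) =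
        norm c * weighted_snorm \<omega> \<nu> G j m p f" by (simp add: FV_simps)
  qed
qed

lemma lc_hausdorff_fun_space_FV:
  assumes "dom_space \<omega> \<nu> Y G"
  shows "lc_hausdorff_fun_space Y (FV \<omega> \<nu> Y G)"
proof -
  interpret FV: seminormed_space "FV \<omega> \<nu> Y G" by (rule seminormed_space_FV)
  show ?thesis
    using assms FV.vector_space FV.subspace FV.seminorm F_set_subset FV_subset_F_set
    by (auto simp: lc_hausdorff_fun_space_def lc_hausdorff_def dom_space_def FV_simps)
qed

end

lemma seminormed_space_of_lcHs: "lcHs E \<Longrightarrow> seminormed_space E"
  by (auto simp: lcHs_def lc_hausdorff_def intro: seminormed_space.intro)

text \<open>A point at which all seminorms vanish lies in every ball around 0.\<close>

lemma (in seminormed_space) separated: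
  assumes "Hausdorff_space (lcs_top V)" and v: "v \<in> vcar V" and zero: "\<And>q. q \<in> snorms V \<Longrightarrow> q v = 0"
  shows "v = 0"
proof (rule ccontr)
  assume "v \<noteq> 0"
  then obtain U U' where U: "openin (lcs_top V) U" "v \<in> U'" "0 \<in> U" "disjnt U' U"
    using assms(1) v carrier(1) unfolding Hausdorff_space_def topspace_lcs_top by metis
  obtain Q r where Q: "Q \<subseteq> snorms V" "0 < r" "ball 0 Q r \<subseteq> U"
    using U(1,3) unfolding openin_iff_ball by blast
  have "q v < r" if "q \<in> Q" for q using zero[of q] that Q(1,2) by auto
  then have "v \<in> ball 0 Q r" using v by (simp add: ball_def)
  with Q(3) U(2,4) show False by (auto simp: disjnt_iff)
qed

section \<open>The map S of a consistent generator\<close>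

locale consistent_generator = E: seminormed_space E
  for E :: "('k::real_or_complex, 'e::ab_group_add) lcs" +
  fixes \<omega> :: "'m \<Rightarrow> 'x set"
    and \<nu> :: "'j \<Rightarrow> 'm \<Rightarrow> 'x \<Rightarrow> real"
    and GE :: "('w, 'm, 'x, 'e) oper_family"
    and GK :: "('w, 'm, 'x, 'k) oper_family"
  assumes Hausdorff: "Hausdorff_space (lcs_top E)"
    and generator: "generator \<omega> \<nu> E GE GK"
    and consistent: "consistent \<omega> \<nu> E GE GK"
begin

sublocale FE: weighted_space E \<omega> \<nu> GE
  using generator by unfold_locales (auto simp: generator_def)

sublocale FK: weighted_space scalars \<omega> \<nu> GK
  using generator by unfold_locales (auto simp: generator_def)

abbreviation V :: "('k, 'w \<Rightarrow> 'k) lcs" where "V \<equiv> FV \<omega> \<nu> scalars GK"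
abbreviation VE :: "('k, 'w \<Rightarrow> 'e) lcs" where "VE \<equiv> FV \<omega> \<nu> E GE"
abbreviation eps :: "('k, (('w \<Rightarrow> 'k) \<Rightarrow> 'k) \<Rightarrow> 'e) lcs" where "eps \<equiv> eps_product V E"

sublocale V: seminormed_space V by (rule FK.seminormed_space_FV)
sublocale VE: seminormed_space VE by (rule FE.seminormed_space_FV)
sublocale VtoE: seminormed_space_pair V E by standard
sublocale eps: seminormed_space eps by (rule VtoE.seminormed_space_eps_product)
sublocale S: seminormed_space_pair eps VE by standard

lemma delta_in_dual: "\<delta> V x \<in> dual V"
  using generator by (simp add: generator_def scalar_dom_space_def)

lemma S_map_oper:
  "u \<in> vcar eps \<Longrightarrow> S_map V u \<in> F_set GE"
  "u \<in> vcar eps \<Longrightarrow> x \<in> \<omega> m \<Longrightarrow> oper GE m (S_map V u) x = u (T_at \<omega> \<nu> GK m x)"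
  using consistent unfolding consistent_def by blast+

definition weighted_T :: "'j \<Rightarrow> 'm \<Rightarrow> 'x \<Rightarrow> ('w \<Rightarrow> 'k) \<Rightarrow> 'k" where
  "weighted_T j m x = (\<lambda>f. of_real (\<nu> j m x) * T_at \<omega> \<nu> GK m x f)"

lemma snorm_V: "weighted_snorm \<omega> \<nu> GK j m norm \<in> snorms V"
  by (auto simp: FK.FV_simps)

lemma norm_weighted_T:
  assumes "f \<in> vcar V" "x \<in> \<omega> m"
  shows "norm (weighted_T j m x f) = norm (oper GK m f x) * \<nu> j m x"
  using assms FK.weight(2) by (simp add: weighted_T_def T_at_def restrict0_def norm_mult mult.commute)

lemma norm_weighted_T_le:
  assumes "f \<in> vcar V" "x \<in> \<omega> m"
  shows "norm (weighted_T j m x f) \<le> weighted_snorm \<omega> \<nu> GK j m norm f"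
  using FK.weighted_snorm_upper[OF assms(1) _ assms(2), of norm j] norm_weighted_T[OF assms] by simp

text \<open>Some weight is positive at \<open>x\<close>, and dividing by it bounds the functional by
  one weighted seminorm.\<close>

lemma T_at_in_dual:
  assumes x: "x \<in> \<omega> m" shows "T_at \<omega> \<nu> GK m x \<in> dual V"
proof -
  obtain j where j: "0 < \<nu> j m x" using FK.weight(3)[OF x] by blast
  have "V.dominated (\<lambda>f. norm (T_at \<omega> \<nu> GK m x f))"
  proof (rule V.dominated_mono)
    show "V.dominated (\<lambda>f. (1 / \<nu> j m x) * weighted_snorm \<omega> \<nu> GK j m norm f)"
      using j by (intro V.dominated_scale V.dominated_snorm snorm_V) simp
    fix f assume "f \<in> vcar V"
    from norm_weighted_T_le[OF this x, of j] j
    show "norm (T_at \<omega> \<nu> GK m x f) \<le> (1 / \<nu> j m x) * weighted_snorm \<omega> \<nu> GK j m norm f"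
      by (simp add: weighted_T_def norm_mult field_simps)
  qed
  moreover have "linear_on V scalars (T_at \<omega> \<nu> GK m x)"
    using FK.oper(2,3)[OF x FK.FV_subset_F_set] FK.FV_subset_F_set
      V.carrier(2) V.carrier(4)
    by (simp add: linear_on_def T_at_def restrict0_def FK.FV_simps)
  ultimately show ?thesis by (simp add: V.dual_iff T_at_def restrict0_def)
qed

lemma weighted_T_in_dual: "x \<in> \<omega> m \<Longrightarrow> weighted_T j m x \<in> dual V"
  unfolding weighted_T_def by (intro V.dual_closed T_at_in_dual)

lemma equicontinuous_weighted_T: "equicontinuous V (weighted_T j m ` \<omega> m)"
  unfolding V.equicontinuous_iff_dominated
  using V.dominated_snorm[OF snorm_V[of j m]] weighted_T_in_dual norm_weighted_T_le by blast

text \<open>After consistency has replaced the operator by \<open>u\<close>, the nonnegative weight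
  is the norm of a scalar and moves through \<open>p\<close> and \<open>u\<close> into the
  functional.\<close>

lemma snorm_S_map:
  assumes u: "u \<in> vcar eps" and x: "x \<in> \<omega> m" and p: "p \<in> snorms E"
  shows "p (oper GE m (S_map V u) x) * \<nu> j m x = p (u (weighted_T j m x))"
  using E.snorm_scale[OF p VtoE.eps_productD(1)[OF u T_at_in_dual[OF x]]] FK.weight(2)[OF x]
  by (simp add: S_map_oper(2)[OF u x] weighted_T_def VtoE.eps_productD(3)[OF u T_at_in_dual[OF x]])

lemma weighted_snorm_S_map:
  assumes u: "u \<in> vcar eps" and p: "p \<in> snorms E"
  shows "weighted_snorm \<omega> \<nu> GE j m p (S_map V u) = (SUP y\<in>weighted_T j m ` \<omega> m. p (u y))"
  unfolding weighted_snorm_def image_image using snorm_S_map[OF u _ p]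
  by (intro arg_cong[of _ _ Sup] image_cong) simp_all

lemma S_map_in_FV:
  assumes u: "u \<in> vcar eps" shows "S_map V u \<in> vcar VE"
proof (rule FE.FV_I[OF S_map_oper(1)[OF u]])
  fix j m p assume p: "p \<in> snorms E"
  show "\<exists>b. \<forall>x\<in>\<omega> m. p (oper GE m (S_map V u) x) * \<nu> j m x \<le> b"
    using VtoE.eps_product_bounded[OF u equicontinuous_weighted_T p, of j m]
    by (auto simp: bdd_above_def snorm_S_map[OF u _ p])
qed

lemma linear_S_map: "linear_on eps VE (S_map V)"
  using S_map_in_FV
  by (auto simp: linear_on_def S_map_def VtoE.eps_product_simps FE.FV_simps pw_scl_def fun_eq_iff)

text \<open>The pulled back seminorm agrees with one of the defining seminorms of the epsilon
  product.\<close>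

lemma S_map_bounded:
  assumes "q \<in> snorms VE" shows "eps.dominated (\<lambda>u. q (S_map V u))"
proof -
  obtain j m p where q: "q = weighted_snorm \<omega> \<nu> GE j m p" and p: "p \<in> snorms E"
    using assms by (auto simp: FE.FV_simps)
  have "(\<lambda>u. SUP y\<in>weighted_T j m ` \<omega> m. p (u y)) \<in> snorms eps"
    unfolding VtoE.eps_product_simps using p FK.weight(1) equicontinuous_weighted_T by blast
  from eps.dominated_mono[OF eps.dominated_snorm[OF this]] show ?thesis
    by (simp add: q weighted_snorm_S_map[OF _ p])
qed

text \<open>Stated for the elements of \<open>B\<close> instead of the supremum, it gives continuity
  of the inverse and, for singletons \<open>B\<close>, injectivity.\<close>

lemma S_map_bounded_below:
  assumes B: "equicontinuous V B" and p: "p \<in> snorms E"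
  shows "\<exists>g. VE.dominated g \<and> (\<forall>u\<in>vcar eps. \<forall>y\<in>B. p (u y) \<le> g (S_map V u))"
proof -
  have BD: "y \<in> dual V" if "y \<in> B" for y using B that by (auto simp: equicontinuous_def)
  obtain h where h: "V.dominated h" "\<And>y f. y \<in> B \<Longrightarrow> f \<in> vcar V \<Longrightarrow> norm (y f) \<le> h f"
    using B by (auto simp: V.equicontinuous_iff_dominated)
  obtain Q C where Q: "finite Q" "Q \<subseteq> snorms V" "0 \<le> C"
    "\<And>f. f \<in> vcar V \<Longrightarrow> h f \<le> C * (\<Sum>q\<in>Q. q f)"
    using h(1) V.dominatedE by blast
  define snorm where "snorm = (\<lambda>(j, m). weighted_snorm \<omega> \<nu> GK j m norm)"
  have "Q \<subseteq> snorm ` UNIV" using Q(2) by (auto simp: FK.FV_simps snorm_def image_iff)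
  then obtain I where I: "finite I" "Q = snorm ` I" using finite_subset_image[OF Q(1)] by metis
  define A where "A = (\<Union>(j, m)\<in>I. weighted_T j m ` \<omega> m)"
  \<comment> \<open>Each seminorm in \<open>Q\<close> is the supremum of |a(f)| over one of the sets
    making up \<open>A\<close>, hence at most \<open>M\<close>; the factor \<open>card Q\<close>
    comes from summing them.\<close>
  have bipolar: "norm (y f) \<le> (C * card Q) * M"
    if y: "y \<in> B" and f: "f \<in> vcar V" and M: "\<And>a. a \<in> A \<Longrightarrow> norm (a f) \<le> M" for y f M
  proof -
    have "q f \<le> M" if "q \<in> Q" for q
    proof -
      obtain j m where jm: "(j, m) \<in> I" "q = weighted_snorm \<omega> \<nu> GK j m norm"
        using \<open>q \<in> Q\<close> I(2) by (auto simp: snorm_def)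
      then have "norm (weighted_T j m x f) \<le> M" if "x \<in> \<omega> m" for x
        using that by (intro M) (auto simp: A_def)
      then show ?thesis unfolding jm(2)
        by (intro FK.weighted_snorm_least) (simp add: norm_weighted_T[OF f])
    qed
    then have "(\<Sum>q\<in>Q. q f) \<le> card Q * M" by (rule sum_bounded_above)
    then have "C * (\<Sum>q\<in>Q. q f) \<le> C * (card Q * M)" using Q(3) by (rule mult_left_mono)
    with h(2)[OF y f] Q(4)[OF f] show ?thesis by (simp add: mult.assoc)
  qed
  \<comment> \<open>The vector-valued counterparts of the seminorms in \<open>Q\<close>; their sum
    bounds p(u(a)) for all \<open>a\<close> in \<open>A\<close> and stays dominated.\<close>
  define M where "M F = (\<Sum>(j, m)\<in>I. weighted_snorm \<omega> \<nu> GE j m p F)" for F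
  have snorm_VE: "weighted_snorm \<omega> \<nu> GE j m p \<in> snorms VE" for j m
    unfolding FE.FV_simps using p by blast
  have dom: "VE.dominated (\<lambda>F. (C * card Q) * M F)"
    unfolding M_def using Q(3) I(1)
    by (intro VE.dominated_scale VE.dominated_sum) (auto intro: VE.dominated_snorm snorm_VE)
  have "p (u y) \<le> (C * card Q) * M (S_map V u)" if u: "u \<in> vcar eps" and y: "y \<in> B" for u y
  proof (rule VtoE.bipolar_estimate[OF bipolar[OF y] u p _ BD[OF y]])
    show "A \<subseteq> dual V" using weighted_T_in_dual by (auto simp: A_def)
    fix a assume "a \<in> A"
    then obtain j m x where a: "(j, m) \<in> I" "x \<in> \<omega> m" "a = weighted_T j m x" by (auto simp: A_def)
    have "p (u a) \<le> weighted_snorm \<omega> \<nu> GE j m p (S_map V u)"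
      using FE.weighted_snorm_upper[OF S_map_in_FV[OF u] p a(2), of j]
      by (simp add: a(3) snorm_S_map[OF u a(2) p])
    also have "\<dots> \<le> M (S_map V u)"
      unfolding M_def
      using member_le_sum[of "(j, m)" I "\<lambda>(j, m). weighted_snorm \<omega> \<nu> GE j m p (S_map V u)"]
        I(1) a(1) VE.snorm_nonneg[OF snorm_VE S_map_in_FV[OF u]] by auto
    finally show "p (u a) \<le> M (S_map V u)" .
  qed
  with dom show ?thesis by blast
qed

text \<open>The lower estimate for the single functional \<open>y\<close> gives p(u(y)) \<le> g(0)
  \<le> 0 for every seminorm \<open>p\<close>, so u(y) vanishes because \<open>E\<close> is
  Hausdorff.\<close>

lemma S_map_injective:
  assumes u: "u \<in> vcar eps" and zero: "S_map V u = 0"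
  shows "u = 0"
proof
  fix y
  show "u y = 0 y"
  proof (cases "y \<in> dual V")
    case True
    have "p (u y) = 0" if p: "p \<in> snorms E" for p
    proof -
      obtain g where g: "VE.dominated g" "p (u y) \<le> g (S_map V u)"
        using S_map_bounded_below[OF V.equicontinuous_singleton[OF True] p] u by blast
      obtain Q C where Q: "finite Q" "Q \<subseteq> snorms VE" "0 \<le> C"
        "\<And>F. F \<in> vcar VE \<Longrightarrow> g F \<le> C * (\<Sum>q\<in>Q. q F)"
        using g(1) VE.dominatedE by blast
      have "q 0 = 0" if "q \<in> Q" for q using Q(2) that by (intro VE.snorm_zero) (rule subsetD)
      then have "(\<Sum>q\<in>Q. q 0) = 0" by (rule sum.neutral[OF ballI])
      with Q(4)[OF VE.carrier(1)] have "g 0 \<le> 0" by simp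
      with g(2) zero E.snorm_nonneg[OF p VtoE.eps_productD(1)[OF u True]] show ?thesis by simp
    qed
    then show ?thesis using E.separated[OF Hausdorff VtoE.eps_productD(1)[OF u True]] by simp
  qed (simp add: VtoE.eps_productD(5)[OF u])
qed

lemma iso_into_S_map: "iso_into eps VE (S_map V)"
proof (rule S.iso_intoI[OF linear_S_map S_map_injective S_map_bounded])
  fix q assume "q \<in> snorms eps"
  then obtain B p where B: "B \<noteq> {}" "equicontinuous V B" "p \<in> snorms E"
    and q: "q = (\<lambda>u. SUP y\<in>B. p (u y))" by (auto simp: VtoE.eps_product_simps)
  obtain g where "VE.dominated g" "\<And>u y. u \<in> vcar eps \<Longrightarrow> y \<in> B \<Longrightarrow> p (u y) \<le> g (S_map V u)"
    using S_map_bounded_below[OF B(2,3)] by blast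
  with B(1) show "\<exists>g. VE.dominated g \<and> (\<forall>u\<in>vcar eps. q u \<le> g (S_map V u))"
    unfolding q by (intro exI[of _ g] conjI ballI cSUP_least) auto
qed

end

theorem theorem3p1p12:
  fixes E :: "('k::real_or_complex, 'e::ab_group_add) lcs"
    and \<omega> :: "'m \<Rightarrow> 'x set"
    and \<nu> :: "'j \<Rightarrow> 'm \<Rightarrow> 'x \<Rightarrow> real"
    and GE :: "('w, 'm, 'x, 'e) oper_family"
    and GK :: "('w, 'm, 'x, 'k) oper_family"
  assumes "lcHs E"
    and "generator \<omega> \<nu> E GE GK"
    and "consistent \<omega> \<nu> E GE GK"
  shows "eps_into_compatible (FV \<omega> \<nu> scalars GK) E (FV \<omega> \<nu> E GE)"
proof -
  interpret seminormed_space E by (rule seminormed_space_of_lcHs[OF assms(1)])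
  interpret consistent_generator E \<omega> \<nu> GE GK
    using assms by unfold_locales (simp_all add: lcHs_def lc_hausdorff_def)
  show ?thesis
    using assms(2) FE.lc_hausdorff_fun_space_FV FK.lc_hausdorff_fun_space_FV delta_in_dual iso_into_S_map
    by (simp add: eps_into_compatible_def generator_def scalar_dom_space_def)
qed

end
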